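(* Let $T$ be a partial isometry on a complex Hilbert space $\mathcal{H}$. Then the Harnack part $\Delta(T)$ of $T$ coincides with its Shmul'yan part $\Delta_{\mathrm{Sh}}(T)$, and $T$ is the only partial isometry in $\Delta(T)$.
   Context: A contraction is a bounded linear operator of norm at most $1$; $\operatorname{Re}A=\frac12(A+A^* )$. $A$ is a partial isometry if $AA^*A=A$. For a contraction $A$, $D_A=(I-A^*A)^{1/2}$ and $\mathcal{D}_A=\overline{\mathcal{R}(D_A)}$. Harnack domination: for contractions $T,T'$ on $\mathcal{H}$, $T$ is Harnack dominated by $T'$ if there is a constant $c\ge 1$ such that $\operatorname{Re}p(T)\le c\,\operatorname{Re}p(T')$ for every analytic polynomial $p$ with $\operatorname{Re}p(z)\ge 0$ for $|z|\le 1$. $T,T'$ are Harnack equivalent if each is Harnack dominated by the other; the Harnack part $\Delta(T)$ is the set of contractions on $\mathcal{H}$ Harnack equivalent to $T$. Shmul'yan domination: for contractions $A,B$ on $\mathcal{H}$, $A$ Shmul'yan dominates $B$ if $B=A+D_{A^*}XD_A$ for some bounded $X\in\mathcal{B}(\mathcal{D}_A,\mathcal{D}_{A^*})$. $A,B$ are Shmul'yan equivalent if each Shmul'yan dominates the other; the Shmul'yan part $\Delta_{\mathrm{Sh}}(T)$ is the set of contractions on $\mathcal{H}$ Shmul'yan equivalent to $T$. *)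

theory Defs
  imports "HOL-Analysis.Analysis" "HOL-Computational_Algebra.Polynomial"
begin

text \<open>Complex Hilbert spaces. The inner product is linear in the first argument; the real inner
  product, norm and metric of the type are the ones induced by it.\<close>

class complex_hilbert = real_inner + banach +
  fixes scaleC :: "complex \<Rightarrow> 'a \<Rightarrow> 'a" (infixr \<open>*\<^sub>C\<close> 75)
    and cinner :: "'a \<Rightarrow> 'a \<Rightarrow> complex"
  assumes scaleC_add_right: "a *\<^sub>C (x + y) = a *\<^sub>C x + a *\<^sub>C y"
    and scaleC_add_left: "(a + b) *\<^sub>C x = a *\<^sub>C x + b *\<^sub>C x"
    and scaleC_scaleC: "a *\<^sub>C b *\<^sub>C x = (a * b) *\<^sub>C x"
    and scaleR_scaleC: "r *\<^sub>R x = of_real r *\<^sub>C x"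
    and cinner_commute: "cinner x y = cnj (cinner y x)"
    and cinner_add_left: "cinner (x + y) z = cinner x z + cinner y z"
    and cinner_scaleC_left: "cinner (a *\<^sub>C x) y = a * cinner x y"
    and inner_eq_Re_cinner: "inner x y = Re (cinner x y)"

instantiation complex :: complex_hilbert
begin

definition scaleC_complex :: "complex \<Rightarrow> complex \<Rightarrow> complex" where
  "scaleC_complex a x = a * x"

definition cinner_complex :: "complex \<Rightarrow> complex \<Rightarrow> complex" where
  "cinner_complex x y = x * cnj y"

instance
  by standard
    (simp_all add: scaleC_complex_def cinner_complex_def algebra_simps scaleR_conv_of_real
      inner_complex_def)

end

definition bounded_clinear :: "('a::complex_hilbert \<Rightarrow> 'a) \<Rightarrow> bool" where
  "bounded_clinear A \<longleftrightarrow> bounded_linear A \<and> (\<forall>c x. A (c *\<^sub>C x) = c *\<^sub>C A x)"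

definition cadjoint :: "('a::complex_hilbert \<Rightarrow> 'a) \<Rightarrow> 'a \<Rightarrow> 'a" where
  "cadjoint A = (THE B. bounded_clinear B \<and> (\<forall>x y. cinner (A x) y = cinner x (B y)))"

definition contraction :: "('a::complex_hilbert \<Rightarrow> 'a) \<Rightarrow> bool" where
  "contraction A \<longleftrightarrow> bounded_clinear A \<and> onorm A \<le> 1"

definition partial_isometry :: "('a::complex_hilbert \<Rightarrow> 'a) \<Rightarrow> bool" where
  "partial_isometry A \<longleftrightarrow> bounded_clinear A \<and> A \<circ> cadjoint A \<circ> A = A"

definition op_Re :: "('a::complex_hilbert \<Rightarrow> 'a) \<Rightarrow> 'a \<Rightarrow> 'a" where
  "op_Re A = (\<lambda>x. (1/2) *\<^sub>R (A x + cadjoint A x))"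

definition positive_op :: "('a::complex_hilbert \<Rightarrow> 'a) \<Rightarrow> bool" where
  "positive_op A \<longleftrightarrow> bounded_clinear A \<and> (\<forall>x. cinner (A x) x \<in> \<real>\<^sub>\<ge>\<^sub>0)"

definition op_le :: "('a::complex_hilbert \<Rightarrow> 'a) \<Rightarrow> ('a \<Rightarrow> 'a) \<Rightarrow> bool" where
  "op_le A B \<longleftrightarrow> positive_op (\<lambda>x. B x - A x)"

definition sqrt_op :: "('a::complex_hilbert \<Rightarrow> 'a) \<Rightarrow> 'a \<Rightarrow> 'a" where
  "sqrt_op A = (THE S. positive_op S \<and> S \<circ> S = A)"

definition poly_op :: "complex poly \<Rightarrow> ('a::complex_hilbert \<Rightarrow> 'a) \<Rightarrow> 'a \<Rightarrow> 'a" where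
  "poly_op p A = (\<lambda>x. \<Sum>i\<le>degree p. coeff p i *\<^sub>C (A ^^ i) x)"

definition defect_op :: "('a::complex_hilbert \<Rightarrow> 'a) \<Rightarrow> 'a \<Rightarrow> 'a" where
  "defect_op A = sqrt_op (\<lambda>x. x - cadjoint A (A x))"

definition defect_space :: "('a::complex_hilbert \<Rightarrow> 'a) \<Rightarrow> 'a set" where
  "defect_space A = closure (range (defect_op A))"

text \<open>\<open>X\<close> represents an element of \<open>\<B>(U, V)\<close>, for subspaces \<open>U\<close> and \<open>V\<close>; its values outside
  \<open>U\<close> are irrelevant.\<close>

definition bounded_clinear_between ::
    "'a set \<Rightarrow> 'a set \<Rightarrow> ('a::complex_hilbert \<Rightarrow> 'a) \<Rightarrow> bool" where
  "bounded_clinear_between U V X \<longleftrightarrow>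
     (\<forall>x\<in>U. X x \<in> V) \<and>
     (\<forall>x\<in>U. \<forall>y\<in>U. X (x + y) = X x + X y) \<and>
     (\<forall>c. \<forall>x\<in>U. X (c *\<^sub>C x) = c *\<^sub>C X x) \<and>
     (\<exists>K. \<forall>x\<in>U. norm (X x) \<le> K * norm x)"

definition harnack_dominated ::
    "('a::complex_hilbert \<Rightarrow> 'a) \<Rightarrow> ('a \<Rightarrow> 'a) \<Rightarrow> bool" where
  "harnack_dominated T T' \<longleftrightarrow>
     (\<exists>c\<ge>1. \<forall>p. (\<forall>z. cmod z \<le> 1 \<longrightarrow> 0 \<le> Re (poly p z)) \<longrightarrow>
        op_le (op_Re (poly_op p T)) (\<lambda>x. c *\<^sub>R op_Re (poly_op p T') x))"

definition harnack_equivalent ::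
    "('a::complex_hilbert \<Rightarrow> 'a) \<Rightarrow> ('a \<Rightarrow> 'a) \<Rightarrow> bool" where
  "harnack_equivalent T T' \<longleftrightarrow> harnack_dominated T T' \<and> harnack_dominated T' T"

definition harnack_part :: "('a::complex_hilbert \<Rightarrow> 'a) \<Rightarrow> ('a \<Rightarrow> 'a) set" where
  "harnack_part T = {S. contraction S \<and> harnack_equivalent S T}"

definition shmulyan_dominates ::
    "('a::complex_hilbert \<Rightarrow> 'a) \<Rightarrow> ('a \<Rightarrow> 'a) \<Rightarrow> bool" where
  "shmulyan_dominates A B \<longleftrightarrow>
     (\<exists>X. bounded_clinear_between (defect_space A) (defect_space (cadjoint A)) X \<and>
        B = (\<lambda>x. A x + defect_op (cadjoint A) (X (defect_op A x))))"

definition shmulyan_equivalent ::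
    "('a::complex_hilbert \<Rightarrow> 'a) \<Rightarrow> ('a \<Rightarrow> 'a) \<Rightarrow> bool" where
  "shmulyan_equivalent A B \<longleftrightarrow> shmulyan_dominates A B \<and> shmulyan_dominates B A"

definition shmulyan_part :: "('a::complex_hilbert \<Rightarrow> 'a) \<Rightarrow> ('a \<Rightarrow> 'a) set" where
  "shmulyan_part T = {S. contraction S \<and> shmulyan_equivalent S T}"

end

theory Submission
  imports Defs
begin

text \<open>Both parts of a partial isometry \<open>T\<close> consist of the operators \<open>S = T + X\<close>, where \<open>X\<close> is a
  strict contraction from the kernel of \<open>T\<close> to the kernel of \<open>T\<^sup>*\<close>. For the Shmul'yan part this
  holds because the defect operators of \<open>T\<close> are the projections to these kernels, and \<open>D\<^sub>S\<^sup>2\<close> is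
  \<open>I - X\<^sup>* X\<close> on the kernel of \<open>T\<close> and 0 on its complement. If \<open>S\<close> is Harnack dominated by \<open>T\<close>,
  averaging the Harnack inequality for Poisson kernels over roots of unity gives
  \<open>\<parallel>g\<parallel>\<^sup>2 + \<parallel>h\<parallel>\<^sup>2 + 2 Re \<langle>S g, h\<rangle> \<le> c (\<parallel>g\<parallel>\<^sup>2 + \<parallel>h\<parallel>\<^sup>2 + 2 Re \<langle>T g, h\<rangle>)\<close>.
  Together with the same inequality for the reverse domination, the choices \<open>h = - T g\<close>, \<open>h = - S g\<close>
  and \<open>g = - T\<^sup>* h\<close> force the above shape of \<open>S\<close>. Conversely the Poisson kernels of \<open>T\<close> and \<open>T + X\<close>
  are comparable uniformly on the disc, and integrating \<open>Re p\<close> against them gives the Harnack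
  inequalities.\<close>

section \<open>Complex Hilbert spaces\<close>

text \<open>In either equivalence the two dominations have complementary jobs. One is controlled by
  the defect of \<open>T\<close>, so it fixes the shape of \<open>S\<close>: the difference lives on
  the kernel of \<open>T\<close> and is orthogonal to the range of \<open>T\<close>. The other
  bounds the difference \<open>X\<close> on that kernel by the defect of \<open>S\<close>, that is
  \<open>a\<^sup>2 \<le> C (b\<^sup>2 - a\<^sup>2)\<close> with \<open>a\<close> the norm of
  \<open>X v\<close> and \<open>b\<close> the norm of \<open>v\<close>. This bound contains
  \<open>a\<close> on both sides and therefore forces norm below 1, not merely at most 1. Strictness
  then keeps the Poisson kernels comparable up to the circle, makes the operators needed for
  Shmul'yan domination invertible, and excludes a second partial isometry. The obstacle on the
  Harnack side is that only polynomials are tested, and only at one vector. Hence Poisson kernels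
  are truncated, and circle integrals become averages over enough roots of unity, where
  orthogonality of powers is exact. The limits in the truncation and in the radius come last.
  Adjoints and square roots are given by definite descriptions, so existence and uniqueness of both
  must precede any work with defect operators.\<close>

lemma scaleC_zero_right [simp]: "a *\<^sub>C (0::'a::complex_hilbert) = 0"
  using scaleC_add_right[of a "0::'a" 0] by simp

lemma scaleC_minus_right: "a *\<^sub>C (- x) = - (a *\<^sub>C (x::'a::complex_hilbert))"
  using scaleC_add_right[of a x "- x"] by (simp add: eq_neg_iff_add_eq_0 add.commute)

lemma scaleC_diff_right: "a *\<^sub>C (x - y) = a *\<^sub>C x - a *\<^sub>C (y::'a::complex_hilbert)"
  using scaleC_add_right[of a x "- y"] by (simp add: scaleC_minus_right)

lemma cinner_add_right: "cinner x (y + z) = cinner x y + cinner x (z::'a::complex_hilbert)"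
  by (metis cinner_add_left cinner_commute complex_cnj_add)

lemma cinner_scaleC_right: "cinner x (a *\<^sub>C y) = cnj a * cinner x (y::'a::complex_hilbert)"
  by (metis cinner_scaleC_left cinner_commute complex_cnj_mult)

lemma cinner_zero_left [simp]: "cinner 0 (x::'a::complex_hilbert) = 0"
  using cinner_add_left[of 0 0 x] by simp

lemma cinner_zero_right [simp]: "cinner (x::'a::complex_hilbert) 0 = 0"
  using cinner_add_right[of x 0 0] by simp

lemma cinner_minus_left: "cinner (- x) (y::'a::complex_hilbert) = - cinner x y"
  using cinner_add_left[of x "- x" y] by (simp add: eq_neg_iff_add_eq_0 add.commute)

lemma cinner_minus_right: "cinner x (- (y::'a::complex_hilbert)) = - cinner x y"
  using cinner_add_right[of x y "- y"] by (simp add: eq_neg_iff_add_eq_0 add.commute)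

lemma cinner_diff_left: "cinner (x - y) (z::'a::complex_hilbert) = cinner x z - cinner y z"
  using cinner_add_left[of x "- y" z] by (simp add: cinner_minus_left)

lemma cinner_diff_right: "cinner x (y - (z::'a::complex_hilbert)) = cinner x y - cinner x z"
  using cinner_add_right[of x y "- z"] by (simp add: cinner_minus_right)

lemma cinner_scaleR_left: "cinner (r *\<^sub>R x) (y::'a::complex_hilbert) = of_real r * cinner x y"
  by (simp add: scaleR_scaleC cinner_scaleC_left)

lemma cinner_scaleR_right: "cinner x (r *\<^sub>R (y::'a::complex_hilbert)) = of_real r * cinner x y"
  by (simp add: scaleR_scaleC cinner_scaleC_right)

lemma cinner_sum_left:
  "cinner (\<Sum>i\<in>I. f i) (y::'a::complex_hilbert) = (\<Sum>i\<in>I. cinner (f i) y)"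
  by (induction I rule: infinite_finite_induct) (auto simp: cinner_add_left)

lemmas cinner_distribs = cinner_add_left cinner_add_right cinner_diff_left cinner_diff_right
  cinner_minus_left cinner_minus_right cinner_scaleC_left cinner_scaleC_right
  cinner_scaleR_left cinner_scaleR_right

lemma cinner_self: "cinner x (x::'a::complex_hilbert) = of_real ((norm x)\<^sup>2)"
proof -
  have "Im (cinner x x) = 0"
    using arg_cong[OF cinner_commute[of x x], of Im] by simp
  moreover have "Re (cinner x x) = (norm x)\<^sup>2"
    by (simp add: power2_norm_eq_inner inner_eq_Re_cinner)
  ultimately show ?thesis
    by (simp add: complex_eq_iff)
qed

lemma norm_scaleC: "norm (a *\<^sub>C (x::'a::complex_hilbert)) = cmod a * norm x"
proof -
  have "of_real ((norm (a *\<^sub>C x))\<^sup>2) = (of_real ((cmod a * norm x)\<^sup>2) :: complex)"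
    unfolding cinner_self[symmetric] cinner_scaleC_left cinner_scaleC_right
    by (simp add: cinner_self power_mult_distrib complex_norm_square del: of_real_power)
  then have "(norm (a *\<^sub>C x))\<^sup>2 = (cmod a * norm x)\<^sup>2"
    by (simp only: of_real_eq_iff)
  then show ?thesis
    by (simp add: power2_eq_iff_nonneg)
qed

lemma norm_cinner_le: "cmod (cinner x (y::'a::complex_hilbert)) \<le> norm x * norm y"
proof (cases "cinner x y = 0")
  case False
  \<comment> \<open>The phase \<open>a\<close> rotates \<open>x\<close> until the inner product is
    real and nonnegative, which reduces the claim to the real Cauchy-Schwarz inequality.\<close>
  define a where "a = cnj (cinner x y) / of_real (cmod (cinner x y))"
  have "cmod a = 1"
    using False by (simp add: a_def norm_divide)
  have "cinner (a *\<^sub>C x) y = of_real (cmod (cinner x y))"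
    using False by (simp add: cinner_scaleC_left a_def field_simps complex_norm_square[symmetric]
        power2_eq_square[symmetric])
  then have "cmod (cinner x y) = inner (a *\<^sub>C x) y"
    by (simp add: inner_eq_Re_cinner)
  also have "\<dots> \<le> norm (a *\<^sub>C x) * norm y"
    by (rule norm_cauchy_schwarz)
  finally show ?thesis
    using \<open>cmod a = 1\<close> by (simp add: norm_scaleC)
qed simp

lemma Re_cinner_self: "Re (cinner x (x::'a::complex_hilbert)) = (norm x)\<^sup>2"
  by (simp add: cinner_self del: of_real_power)

lemma Re_cinner_commute: "Re (cinner x (y::'a::complex_hilbert)) = Re (cinner y x)"
  using arg_cong[OF cinner_commute[of x y], of Re] by simp

lemma norm_add_square:
  "(norm (x + y))\<^sup>2 = (norm x)\<^sup>2 + (norm y)\<^sup>2 + 2 * Re (cinner x (y::'a::complex_hilbert))"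
  unfolding Re_cinner_self[symmetric] using Re_cinner_commute[of x y] by (simp add: cinner_distribs)

lemma norm_diff_square:
  "(norm (x - y))\<^sup>2 = (norm x)\<^sup>2 + (norm y)\<^sup>2 - 2 * Re (cinner x (y::'a::complex_hilbert))"
  unfolding Re_cinner_self[symmetric] using Re_cinner_commute[of x y] by (simp add: cinner_distribs)

lemma cinner_eqI:
  assumes "\<And>z. cinner x z = cinner y z"
  shows "x = (y::'a::complex_hilbert)"
proof -
  have "cinner (x - y) (x - y) = 0"
    by (simp add: cinner_diff_left assms)
  then show ?thesis
    by (simp add: cinner_self del: of_real_power)
qed

lemma bounded_linear_cinner_left: "bounded_linear (\<lambda>x. cinner x (y::'a::complex_hilbert))"
  by (rule bounded_linear_intro[where K = "norm y"])
    (auto simp: cinner_distribs scaleR_conv_of_real norm_cinner_le)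

lemma bounded_linear_cinner_right: "bounded_linear (\<lambda>x. cinner (y::'a::complex_hilbert) x)"
  by (rule bounded_linear_intro[where K = "norm y"])
    (auto simp: cinner_distribs scaleR_conv_of_real norm_cinner_le mult.commute[of _ "norm y"])

section \<open>Bounded operators and adjoints\<close>

lemma bounded_clinearI:
  assumes "\<And>x y. A (x + y) = A x + A y" "\<And>c x. A (c *\<^sub>C x) = c *\<^sub>C A x"
    "\<And>x. norm (A x) \<le> norm x * K"
  shows "bounded_clinear A"
  unfolding bounded_clinear_def
  by (auto intro!: bounded_linear_intro[where K = K] simp: assms scaleR_scaleC)

lemma bounded_clinear_bounded_linear: "bounded_clinear A \<Longrightarrow> bounded_linear A"
  by (simp add: bounded_clinear_def)

lemma
  assumes "bounded_clinear A"
  shows bounded_clinear_add: "A (x + y) = A x + A y"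
    and bounded_clinear_diff: "A (x - y) = A x - A y"
    and bounded_clinear_minus: "A (- x) = - A x"
    and bounded_clinear_zero: "A 0 = 0"
    and bounded_clinear_scaleC: "A (c *\<^sub>C x) = c *\<^sub>C A x"
    and bounded_clinear_scaleR: "A (r *\<^sub>R x) = r *\<^sub>R A x"
  using assms by (auto simp: bounded_clinear_def linear_simps bounded_linear.linear linear_add
      linear_diff linear_neg linear_0 linear_cmul)

lemma bounded_clinear_id: "bounded_clinear (\<lambda>x. x)"
  by (rule bounded_clinearI[where K = 1]) auto

lemma bounded_clinear_const_zero: "bounded_clinear (\<lambda>x. 0)"
  by (rule bounded_clinearI[where K = 1]) auto

lemma bounded_clinear_plus:
  "bounded_clinear A \<Longrightarrow> bounded_clinear B \<Longrightarrow> bounded_clinear (\<lambda>x. A x + B x)"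
  by (auto simp: bounded_clinear_def bounded_linear_add scaleC_add_right)

lemma bounded_clinear_minus_op:
  "bounded_clinear A \<Longrightarrow> bounded_clinear B \<Longrightarrow> bounded_clinear (\<lambda>x. A x - B x)"
  by (auto simp: bounded_clinear_def bounded_linear_sub scaleC_diff_right)

lemma bounded_clinear_compose:
  "bounded_clinear A \<Longrightarrow> bounded_clinear B \<Longrightarrow> bounded_clinear (\<lambda>x. A (B x))"
  by (auto simp: bounded_clinear_def intro: bounded_linear_compose)

lemma bounded_clinear_const_scaleC:
  assumes "bounded_clinear A"
  shows "bounded_clinear (\<lambda>x. c *\<^sub>C A x)"
proof -
  have "bounded_clinear (\<lambda>x::'a. c *\<^sub>C x)"
    by (rule bounded_clinearI[where K = "cmod c"])
      (auto simp: norm_scaleC scaleC_add_right scaleC_scaleC mult.commute)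
  then show ?thesis
    using assms by (rule bounded_clinear_compose)
qed

lemma bounded_clinear_const_scaleR:
  "bounded_clinear A \<Longrightarrow> bounded_clinear (\<lambda>x. r *\<^sub>R A x)"
  by (simp add: scaleR_scaleC bounded_clinear_const_scaleC)

lemma bounded_clinear_sum:
  "(\<And>i. i \<in> I \<Longrightarrow> bounded_clinear (A i)) \<Longrightarrow> bounded_clinear (\<lambda>x. \<Sum>i\<in>I. A i x)"
  by (induction I rule: infinite_finite_induct)
    (auto intro: bounded_clinear_const_zero bounded_clinear_plus)

lemma bounded_clinear_funpow: "bounded_clinear A \<Longrightarrow> bounded_clinear (A ^^ n)"
  by (induction n) (auto simp: bounded_clinear_id id_def o_def intro: bounded_clinear_compose)

lemmas bounded_clinear_intros = bounded_clinear_id bounded_clinear_const_zero bounded_clinear_plus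
  bounded_clinear_minus_op bounded_clinear_const_scaleC
  bounded_clinear_const_scaleR bounded_clinear_sum bounded_clinear_funpow

lemma contraction_iff:
  "contraction A \<longleftrightarrow> bounded_clinear A \<and> (\<forall>x. norm (A x) \<le> norm x)"
proof
  assume A: "contraction A"
  then have "norm (A x) \<le> norm x" for x
  proof -
    have "norm (A x) \<le> onorm A * norm x"
      using A by (intro onorm) (simp add: contraction_def bounded_clinear_def)
    also have "\<dots> \<le> 1 * norm x"
      using A by (intro mult_right_mono) (auto simp: contraction_def)
    finally show ?thesis by simp
  qed
  then show "bounded_clinear A \<and> (\<forall>x. norm (A x) \<le> norm x)"
    using A by (simp add: contraction_def)
next
  assume "bounded_clinear A \<and> (\<forall>x. norm (A x) \<le> norm x)"
  then show "contraction A"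
    unfolding contraction_def using onorm_bound[of 1 A] by simp
qed

text \<open>The representing vector minimises \<open>\<parallel>x\<parallel>\<^sup>2 - 2 f x\<close>; by the parallelogram law every minimising
  sequence is Cauchy.\<close>

lemma riesz_representation:
  fixes f :: "'a::{real_inner,banach} \<Rightarrow> real"
  assumes f: "bounded_linear f"
  obtains z where "\<And>x. f x = inner x z"
proof -
  interpret bounded_linear f by fact
  define J where "J x = (norm x)\<^sup>2 - 2 * f x" for x
  obtain K where K: "\<And>x. norm (f x) \<le> norm x * K"
    using bounded by blast
  have lower: "- (K\<^sup>2) \<le> J x" for x
  proof -
    have "f x \<le> norm x * K"
      using K[of x] by simp
    moreover have "0 \<le> (norm x - K)\<^sup>2"
      by simp
    ultimately show ?thesis
      by (simp add: J_def power2_diff)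
  qed
  define m where "m = (INF x. J x)"
  have bdd: "bdd_below (range J)"
    using lower by (auto intro!: bdd_belowI)
  have m: "m \<le> J x" for x
    unfolding m_def using bdd by (rule cINF_lower) simp
  have "\<exists>x. J x < m + inverse (real (Suc n))" for n
  proof -
    have "(INF x. J x) < m + inverse (real (Suc n))"
      by (simp add: m_def)
    then show ?thesis
      using bdd cINF_less_iff[of UNIV J] by auto
  qed
  then obtain X where X: "\<And>n. J (X n) < m + inverse (real (Suc n))"
    by metis
  have par: "(norm (x - y))\<^sup>2 \<le> 2 * (J x - m) + 2 * (J y - m)" for x y
  proof -
    have "(norm (x - y))\<^sup>2 = 2 * J x + 2 * J y - 4 * J ((1/2) *\<^sub>R (x + y))"
      by (simp add: J_def scaleR add power2_norm_eq_inner inner_simps inner_commute algebra_simps)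
    then show ?thesis
      using m[of "(1/2) *\<^sub>R (x + y)"] by simp
  qed
  have "Cauchy X"
  proof (rule CauchyI)
    fix e :: real assume e: "0 < e"
    then obtain M where M: "inverse (real (Suc M)) < e\<^sup>2 / 4"
      using reals_Archimedean[of "e\<^sup>2 / 4"] by auto
    show "\<exists>M. \<forall>m\<ge>M. \<forall>n\<ge>M. norm (X m - X n) < e"
    proof (intro exI allI impI)
      fix k l assume kl: "M \<le> k" "M \<le> l"
      have "J (X j) - m < e\<^sup>2 / 4" if "M \<le> j" for j
      proof -
        have "inverse (real (Suc j)) \<le> inverse (real (Suc M))"
          using that by (intro le_imp_inverse_le) auto
        then show ?thesis
          using X[of j] M by linarith
      qed
      from this[OF kl(1)] this[OF kl(2)] par[of "X k" "X l"]
      have "(norm (X k - X l))\<^sup>2 < e\<^sup>2"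
        by simp
      then show "norm (X k - X l) < e"
        using e by (simp add: power2_less_imp_less)
    qed
  qed
  then obtain z where z: "X \<longlonglongrightarrow> z"
    using Cauchy_convergent convergent_def by blast
  have "(\<lambda>n. J (X n)) \<longlonglongrightarrow> J z"
    unfolding J_def by (intro tendsto_intros z tendsto)
  moreover have "(\<lambda>n. J (X n)) \<longlonglongrightarrow> m"
  proof (rule tendsto_sandwich[where f = "\<lambda>_. m" and h = "\<lambda>n. m + inverse (real (Suc n))"])
    show "(\<lambda>n. m + inverse (real (Suc n))) \<longlonglongrightarrow> m"
      using LIMSEQ_inverse_real_of_nat_add .
    show "\<forall>\<^sub>F n in sequentially. J (X n) \<le> m + inverse (real (Suc n))"
      using X by (intro always_eventually allI less_imp_le)
  qed (use m in auto)
  ultimately have "J z = m"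
    by (rule LIMSEQ_unique)
  have "f x = inner x z" for x
  proof (cases "x = 0")
    case False
    \<comment> \<open>This \<open>t\<close> minimises the quadratic polynomial obtained by moving
      from \<open>z\<close> in direction \<open>x\<close>; minimality of \<open>z\<close> leaves no
      room for a linear term.\<close>
    define t where "t = (f x - inner x z) / (norm x)\<^sup>2"
    have "J z \<le> J (z + t *\<^sub>R x)"
      using m \<open>J z = m\<close> by simp
    also have "J (z + t *\<^sub>R x) = J z + t\<^sup>2 * (norm x)\<^sup>2 - 2 * t * (f x - inner x z)"
      unfolding J_def power2_norm_eq_inner
      by (simp add: scaleR add inner_simps inner_commute algebra_simps power2_eq_square)
    also have "\<dots> = J z - (f x - inner x z)\<^sup>2 / (norm x)\<^sup>2"
      using False by (simp add: t_def field_simps power2_eq_square)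
    finally have "(f x - inner x z)\<^sup>2 / (norm x)\<^sup>2 \<le> 0"
      by simp
    then have "(f x - inner x z)\<^sup>2 \<le> 0"
      using False by (simp add: divide_le_0_iff)
    then show ?thesis
      by simp
  qed (simp add: zero)
  then show ?thesis
    using that by blast
qed

text \<open>The real Riesz theorem represents only the real part of the form. Replacing
  \<open>x\<close> by \<open>\<i> *\<^sub>C x\<close> recovers the imaginary part, and complex
  linearity of the representing map then follows from the identity itself.\<close>

lemma cadjoint_exists:
  assumes A: "bounded_clinear A"
  shows "\<exists>B. bounded_clinear B \<and> (\<forall>x y. cinner (A x) y = cinner x (B y))"
proof -
  have "\<exists>z. \<forall>x. inner (A x) y = inner x z" for y
  proof -
    have "bounded_linear (\<lambda>x. inner (A x) y)"
      using A by (intro bounded_linear_compose[OF bounded_linear_inner_left])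
        (simp add: bounded_clinear_def)
    then show ?thesis
      by (metis riesz_representation)
  qed
  then obtain B where "\<And>x y. inner (A x) y = inner x (B y)"
    by metis
  then have re: "Re (cinner (A x) y) = Re (cinner x (B y))" for x y
    by (simp add: inner_eq_Re_cinner)
  have eq: "cinner (A x) y = cinner x (B y)" for x y
  proof (rule complex_eqI)
    show "Im (cinner (A x) y) = Im (cinner x (B y))"
      using re[of "\<i> *\<^sub>C x" y] A by (simp add: bounded_clinear_scaleC cinner_scaleC_left)
  qed (rule re)
  have eq': "cinner (B y) x = cinner y (A x)" for x y
    using eq[of x y] by (metis cinner_commute)
  obtain K where K: "\<And>x. norm (A x) \<le> norm x * K"
    using A bounded_linear.bounded unfolding bounded_clinear_def by blast
  have "bounded_clinear B"
  proof (rule bounded_clinearI)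
    show "B (x + y) = B x + B y" for x y
      by (rule cinner_eqI) (simp add: eq' cinner_add_left)
    show "B (c *\<^sub>C x) = c *\<^sub>C B x" for c x
      by (rule cinner_eqI) (simp add: eq' cinner_scaleC_left)
    show "norm (B x) \<le> norm x * K" for x
    proof (cases "B x = 0")
      case True
      have "0 \<le> norm x * K"
        using order_trans[OF norm_ge_zero K] .
      then show ?thesis
        using True by simp
    next
      case False
      have "norm (B x) * norm (B x) = Re (cinner (B x) (B x))"
        by (simp add: Re_cinner_self power2_eq_square)
      also have "\<dots> = Re (cinner x (A (B x)))"
        by (simp add: eq')
      also have "\<dots> \<le> norm x * norm (A (B x))"
        using norm_cinner_le complex_Re_le_cmod order_trans by blast
      also have "\<dots> \<le> norm x * (norm (B x) * K)"
        by (intro mult_left_mono K) auto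
      finally have "norm (B x) * norm (B x) \<le> norm (B x) * (norm x * K)"
        by (simp add: mult_ac)
      then show ?thesis
        using False by simp
    qed
  qed
  then show ?thesis
    using eq by blast
qed

lemma cadjoint_eqI:
  assumes "bounded_clinear B" "\<And>x y. cinner (A x) y = cinner x (B y)"
  shows "cadjoint A = B"
  unfolding cadjoint_def
proof (rule the_equality)
  fix C assume C: "bounded_clinear C \<and> (\<forall>x y. cinner (A x) y = cinner x (C y))"
  show "C = B"
  proof (rule ext, rule cinner_eqI)
    fix x z
    show "cinner (C x) z = cinner (B x) z"
      by (metis C assms(2) cinner_commute)
  qed
qed (use assms in blast)

lemma
  assumes "bounded_clinear A"
  shows bounded_clinear_cadjoint: "bounded_clinear (cadjoint A)"
    and cinner_cadjoint_right: "cinner x (cadjoint A y) = cinner (A x) y"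
    and cinner_cadjoint_left: "cinner (cadjoint A x) y = cinner x (A y)"
proof -
  obtain B where B: "bounded_clinear B" "\<And>x y. cinner (A x) y = cinner x (B y)"
    using cadjoint_exists[OF assms] by blast
  then have eq: "cadjoint A = B"
    by (rule cadjoint_eqI)
  show "bounded_clinear (cadjoint A)" "cinner x (cadjoint A y) = cinner (A x) y"
    using B eq by auto
  show "cinner (cadjoint A x) y = cinner x (A y)"
    using B eq by (metis cinner_commute)
qed

lemma cadjoint_cadjoint:
  assumes "bounded_clinear A"
  shows "cadjoint (cadjoint A) = A"
  using assms by (intro cadjoint_eqI) (simp_all add: cinner_cadjoint_left)

lemma cadjoint_diff:
  assumes "bounded_clinear A" "bounded_clinear B"
  shows "cadjoint (\<lambda>x. A x - B x) = (\<lambda>x. cadjoint A x - cadjoint B x)"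
  using assms
  by (intro cadjoint_eqI bounded_clinear_minus_op bounded_clinear_cadjoint)
    (simp_all add: cinner_diff_left cinner_diff_right cinner_cadjoint_right)

lemma norm_cadjoint_le:
  assumes A: "bounded_clinear A" and K: "\<And>x. norm (A x) \<le> K * norm x" and "0 \<le> K"
  shows "norm (cadjoint A x) \<le> K * norm x"
proof (cases "cadjoint A x = 0")
  case False
  let ?y = "cadjoint A x"
  have "norm ?y * norm ?y = Re (cinner x (A ?y))"
    using A by (simp add: Re_cinner_self power2_eq_square flip: cinner_cadjoint_left)
  also have "\<dots> \<le> norm x * norm (A ?y)"
    using norm_cinner_le complex_Re_le_cmod order_trans by blast
  also have "\<dots> \<le> norm x * (K * norm ?y)"
    by (intro mult_left_mono K) auto
  finally have "norm ?y * norm ?y \<le> norm ?y * (K * norm x)"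
    by (simp add: mult_ac)
  then show ?thesis
    using False by simp
qed (simp add: \<open>0 \<le> K\<close>)

section \<open>Positive square roots\<close>

lemma positive_op_nonneg:
  assumes "positive_op A"
  shows "0 \<le> Re (cinner (A x) x)" "Im (cinner (A x) x) = 0"
  using assms by (auto simp: positive_op_def complex_nonneg_Reals_iff)

lemma positive_op_bounded_clinear: "positive_op A \<Longrightarrow> bounded_clinear A"
  by (simp add: positive_op_def)

text \<open>Polarisation: the form \<open>D\<close> measuring the failure of symmetry vanishes on
  the diagonal because the quadratic form of \<open>A\<close> is real. Testing it at
  \<open>x + y\<close> and at \<open>\<i> *\<^sub>C x + y\<close> makes it both antisymmetric and
  symmetric.\<close>

lemma positive_op_self_adjoint:
  assumes A: "positive_op A"
  shows "cinner (A x) y = cinner x (A y)"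
proof -
  note lin = positive_op_bounded_clinear[OF A]
  define D where "D x y = cinner (A x) y - cinner x (A y)" for x y
  have D0: "D x x = 0" for x
    using positive_op_nonneg[OF A, of x] cinner_commute[of x "A x"]
    by (simp add: D_def complex_eq_iff)
  have "D x y + D y x = D (x + y) (x + y) - D x x - D y y"
    by (simp add: D_def bounded_clinear_add[OF lin] cinner_distribs)
  then have 1: "D x y + D y x = 0"
    by (simp add: D0)
  have "\<i> * D x y - \<i> * D y x = D (\<i> *\<^sub>C x + y) (\<i> *\<^sub>C x + y) - D x x - D y y"
    by (simp add: D_def bounded_clinear_add[OF lin] bounded_clinear_scaleC[OF lin]
        cinner_distribs algebra_simps)
  then have "\<i> * (D x y - D y x) = 0"
    by (simp add: D0 right_diff_distrib)
  then have 2: "D x y = D y x"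
    by simp
  have "D x y = 0"
    using 1 unfolding 2[symmetric] by simp
  then show ?thesis
    by (simp add: D_def)
qed

text \<open>Moving from \<open>x\<close> a distance \<open>s\<close> along \<open>- A x\<close>
  changes the form by \<open>s\<^sup>2 * b - 2 * s * N\<close>, which is negative for small
  \<open>s\<close>. The choice \<open>s = N / (b + 1)\<close> is small enough, and the
  \<open>+ 1\<close> covers \<open>b = 0\<close>.\<close>

lemma positive_op_eq_0:
  assumes A: "positive_op A" and "cinner (A x) x = 0"
  shows "A x = 0"
proof (rule ccontr)
  assume nz: "A x \<noteq> 0"
  note lin = positive_op_bounded_clinear[OF A]
  define b where "b = Re (cinner (A (A x)) (A x))"
  have b: "0 \<le> b"
    unfolding b_def by (rule positive_op_nonneg[OF A])
  define N where "N = (norm (A x))\<^sup>2"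
  have N: "0 < N"
    using nz by (simp add: N_def)
  define s where "s = N / (b + 1)"
  have s: "0 < s"
    using b N by (simp add: s_def)
  have "0 \<le> Re (cinner (A (x - s *\<^sub>R A x)) (x - s *\<^sub>R A x))"
    by (rule positive_op_nonneg[OF A])
  also have "\<dots> = s * (s * b - 2 * N)"
    using assms(2) positive_op_self_adjoint[OF A, of "A x" x]
    by (simp add: bounded_clinear_diff[OF lin] bounded_clinear_scaleR[OF lin] cinner_distribs
        b_def N_def cinner_self algebra_simps del: of_real_power)
  finally have "2 * N \<le> s * b"
    using s by (simp add: zero_le_mult_iff)
  also have "s * b \<le> N"
    using b N by (simp add: s_def field_simps)
  finally show False
    using N by simp
qed

text \<open>Iterating \<open>Y \<mapsto> (B + Y\<^sup>2) / 2\<close> from 0 solves \<open>(I - Y)\<^sup>2 = I - B\<close>. The increments are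
  dominated by those of the scalar iteration with \<open>B = 1\<close>, which increases to 1.\<close>

primrec sqrt_iter :: "('a::complex_hilbert \<Rightarrow> 'a) \<Rightarrow> nat \<Rightarrow> 'a \<Rightarrow> 'a" where
  "sqrt_iter B 0 = (\<lambda>x. 0)"
| "sqrt_iter B (Suc n) = (\<lambda>x. (1/2) *\<^sub>R (B x + sqrt_iter B n (sqrt_iter B n x)))"

primrec sqrt_iter_bound :: "nat \<Rightarrow> real" where
  "sqrt_iter_bound 0 = 0"
| "sqrt_iter_bound (Suc n) = (1 + (sqrt_iter_bound n)\<^sup>2) / 2"

lemma sqrt_iter_bound_range: "0 \<le> sqrt_iter_bound n" "sqrt_iter_bound n \<le> 1"
proof -
  have "0 \<le> sqrt_iter_bound n \<and> sqrt_iter_bound n \<le> 1"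
    by (induction n) (auto simp: power_le_one)
  then show "0 \<le> sqrt_iter_bound n" "sqrt_iter_bound n \<le> 1"
    by auto
qed

lemma sqrt_iter_bound_mono: "sqrt_iter_bound n \<le> sqrt_iter_bound (Suc n)"
  using zero_le_power2[of "1 - sqrt_iter_bound n"] by (simp add: power2_diff)

text \<open>The third conclusion is recorded for the uniqueness proof. Each iterate is a polynomial
  in \<open>B\<close>, so it commutes with whatever commutes with \<open>B\<close>, and this passes
  to the limit.\<close>

lemma positive_sqrt_exists:
  fixes B :: "'a::complex_hilbert \<Rightarrow> 'a"
  assumes B: "bounded_clinear B" and sa: "\<And>x y. cinner (B x) y = cinner x (B y)"
    and contr: "\<And>x. norm (B x) \<le> norm x"
  obtains S where "positive_op S" "\<And>x. S (S x) = x - B x"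
    "\<And>C x. bounded_clinear C \<Longrightarrow> (\<And>x. C (B x) = B (C x)) \<Longrightarrow> C (S x) = S (C x)"
proof -
  let ?Y = "sqrt_iter B" and ?y = sqrt_iter_bound
  have lin: "bounded_clinear (?Y n)" for n
    by (induction n)
      (auto intro!: bounded_clinear_const_zero bounded_clinear_const_scaleR bounded_clinear_plus B
        intro: bounded_clinear_compose)
  have comm: "C (?Y n x) = ?Y n (C x)"
    if C: "bounded_clinear C" "\<And>x. C (B x) = B (C x)" for C n x
    by (induction n arbitrary: x)
      (auto simp: C bounded_clinear_zero[OF C(1)] bounded_clinear_add[OF C(1)]
        bounded_clinear_scaleR[OF C(1)])
  have sym: "cinner (?Y n x) y = cinner x (?Y n y)" for n x y
    by (induction n arbitrary: x y) (auto simp: sa cinner_distribs)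
  have bound: "norm (?Y n x) \<le> ?y n * norm x" for n x
  proof (induction n arbitrary: x)
    case (Suc n)
    have "norm (?Y n (?Y n x)) \<le> ?y n * norm (?Y n x)"
      by (rule Suc)
    also have "\<dots> \<le> ?y n * (?y n * norm x)"
      by (intro mult_left_mono Suc sqrt_iter_bound_range)
    finally have "norm (B x + ?Y n (?Y n x)) \<le> norm x + ?y n * (?y n * norm x)"
      using contr[of x] by (intro norm_triangle_le) linarith
    then have "norm (?Y (Suc n) x) \<le> (1/2) * (norm x + ?y n * (?y n * norm x))"
      by simp
    then show ?case
      by (simp add: power2_eq_square field_simps del: sqrt_iter.simps)
  qed simp
  have step: "norm (?Y (Suc n) x - ?Y n x) \<le> (?y (Suc n) - ?y n) * norm x" for n x
  proof (induction n arbitrary: x)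
    case 0
    then show ?case
      using contr[of x] by simp
  next
    case (Suc n)
    let ?d = "?y (Suc n) - ?y n"
    have "?Y (Suc (Suc n)) x - ?Y (Suc n) x
        = (1/2) *\<^sub>R (?Y (Suc n) (?Y (Suc n) x) - ?Y n (?Y n x))"
      by (subst (1 2) sqrt_iter.simps(2))
        (simp add: scaleR_diff_right scaleR_add_right del: sqrt_iter.simps)
    \<comment> \<open>The difference of squares is split as for numbers, so that the two induction
      bounds add up to the difference of the squared scalar iterates.\<close>
    also have "?Y (Suc n) (?Y (Suc n) x) - ?Y n (?Y n x)
        = ?Y (Suc n) (?Y (Suc n) x - ?Y n x) + (?Y (Suc n) (?Y n x) - ?Y n (?Y n x))"
      by (simp add: bounded_clinear_diff[OF lin] del: sqrt_iter.simps)
    finally have eq: "?Y (Suc (Suc n)) x - ?Y (Suc n) x = (1/2) *\<^sub>R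
        (?Y (Suc n) (?Y (Suc n) x - ?Y n x) + (?Y (Suc n) (?Y n x) - ?Y n (?Y n x)))" .
    have d: "0 \<le> ?d"
      using sqrt_iter_bound_mono[of n] by simp
    have "norm (?Y (Suc n) (?Y (Suc n) x - ?Y n x)) \<le> ?y (Suc n) * norm (?Y (Suc n) x - ?Y n x)"
      by (rule bound)
    also have "\<dots> \<le> ?y (Suc n) * (?d * norm x)"
      by (intro mult_left_mono Suc sqrt_iter_bound_range)
    finally have 1: "norm (?Y (Suc n) (?Y (Suc n) x - ?Y n x)) \<le> ?y (Suc n) * (?d * norm x)" .
    have "norm (?Y (Suc n) (?Y n x) - ?Y n (?Y n x)) \<le> ?d * norm (?Y n x)"
      by (rule Suc)
    also have "\<dots> \<le> ?d * (?y n * norm x)"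
      by (intro mult_left_mono bound d)
    finally have "norm (?Y (Suc (Suc n)) x - ?Y (Suc n) x)
        \<le> (1/2) * (?y (Suc n) * (?d * norm x) + ?d * (?y n * norm x))"
      unfolding eq norm_scaleR using 1 by (intro mult_mono norm_triangle_le) auto
    also have "\<dots> = (1/2) * ((?y (Suc n))\<^sup>2 - (?y n)\<^sup>2) * norm x"
      by (simp add: power2_eq_square algebra_simps del: sqrt_iter_bound.simps)
    also have "\<dots> = (?y (Suc (Suc n)) - ?y (Suc n)) * norm x"
    proof -
      have "(1/2) * (a - b) = t - s" if "t = (1 + a) / 2" "s = (1 + b) / 2" for a b s t :: real
        using that by (simp add: field_simps)
      from this[OF sqrt_iter_bound.simps(2) sqrt_iter_bound.simps(2)] show ?thesis
        by (simp only:)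
    qed
    finally show ?case .
  qed
  have "incseq ?y"
    by (rule incseq_SucI) (rule sqrt_iter_bound_mono)
  then obtain l where "?y \<longlonglongrightarrow> l"
    using incseq_convergent[of ?y 1] sqrt_iter_bound_range by metis
  then have summ: "summable (\<lambda>n. ?y (Suc n) - ?y n)"
    by (rule telescope_summable)
  have "convergent (\<lambda>n. ?Y n x)" for x
  proof -
    have "summable (\<lambda>n. ?Y (Suc n) x - ?Y n x)"
      by (rule summable_comparison_test'[where g = "\<lambda>n. (?y (Suc n) - ?y n) * norm x" and N = 0])
        (use step summ summable_mult2 in auto)
    then have "convergent (\<lambda>n. \<Sum>k<n. ?Y (Suc k) x - ?Y k x)"
      by (simp add: summable_iff_convergent)
    then have "convergent (\<lambda>n. ?Y n x - ?Y 0 x)"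
      by (simp only: sum_lessThan_telescope[of "\<lambda>n. ?Y n x"])
    then show ?thesis
      by simp
  qed
  then obtain Y where Y: "\<And>x. (\<lambda>n. ?Y n x) \<longlonglongrightarrow> Y x"
    unfolding convergent_def by metis
  have bound1: "norm (?Y n x) \<le> norm x" for n x
    using bound[of n x] sqrt_iter_bound_range(2)[of n] mult_right_mono[of "?y n" 1 "norm x"]
    by simp
  have Ybound: "norm (Y x) \<le> norm x" for x
    by (rule LIMSEQ_le_const2[OF tendsto_norm[OF Y]]) (use bound1 in blast)
  have Yadd: "Y (x + y) = Y x + Y y" for x y
    by (rule LIMSEQ_unique[OF Y]) (auto simp: bounded_clinear_add[OF lin] intro!: tendsto_add Y)
  have Yscale: "Y (c *\<^sub>C x) = c *\<^sub>C Y x" for c x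
  proof -
    have "(\<lambda>n. c *\<^sub>C ?Y n x) \<longlonglongrightarrow> c *\<^sub>C Y x"
      using bounded_linear.tendsto[OF bounded_clinear_bounded_linear[OF
        bounded_clinear_const_scaleC[OF bounded_clinear_id]] Y] .
    then show ?thesis
      using LIMSEQ_unique[OF Y[of "c *\<^sub>C x"]] by (simp add: bounded_clinear_scaleC[OF lin])
  qed
  have Ylin: "bounded_clinear Y"
    by (rule bounded_clinearI[where K = 1]) (auto simp: Yadd Yscale Ybound)
  have Ysym: "cinner (Y x) y = cinner x (Y y)" for x y
  proof (rule LIMSEQ_unique)
    show "(\<lambda>n. cinner (?Y n x) y) \<longlonglongrightarrow> cinner (Y x) y"
      by (rule bounded_linear.tendsto[OF bounded_linear_cinner_left Y])
    show "(\<lambda>n. cinner (?Y n x) y) \<longlonglongrightarrow> cinner x (Y y)"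
      unfolding sym by (rule bounded_linear.tendsto[OF bounded_linear_cinner_right Y])
  qed
  have Ysq: "Y x = (1/2) *\<^sub>R (B x + Y (Y x))" for x
  proof (rule LIMSEQ_unique)
    show "(\<lambda>n. ?Y (Suc n) x) \<longlonglongrightarrow> Y x"
      by (rule LIMSEQ_Suc[OF Y])
    \<comment> \<open>Convergence is only pointwise; the uniform norm bound on the iterates is what
      allows passing to the limit in the composition.\<close>
    have "(\<lambda>n. ?Y n (?Y n x - Y x)) \<longlonglongrightarrow> 0"
    proof (rule Lim_null_comparison)
      show "\<forall>\<^sub>F n in sequentially. norm (?Y n (?Y n x - Y x)) \<le> norm (?Y n x - Y x)"
        using bound1 by simp
      show "(\<lambda>n. norm (?Y n x - Y x)) \<longlonglongrightarrow> 0"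
        using tendsto_norm[OF tendsto_diff[OF Y[of x] tendsto_const[of "Y x"]]] by simp
    qed
    from tendsto_add[OF this Y[of "Y x"]] have "(\<lambda>n. ?Y n (?Y n x)) \<longlonglongrightarrow> Y (Y x)"
      by (simp add: bounded_clinear_diff[OF lin])
    then show "(\<lambda>n. ?Y (Suc n) x) \<longlonglongrightarrow> (1/2) *\<^sub>R (B x + Y (Y x))"
      unfolding sqrt_iter.simps by (intro tendsto_intros)
  qed
  show ?thesis
  proof (rule that)
    show "positive_op (\<lambda>x. x - Y x)"
      unfolding positive_op_def
    proof (intro conjI allI)
      show "bounded_clinear (\<lambda>x. x - Y x)"
        by (intro bounded_clinear_intros Ylin)
      fix x
      have "Im (cinner (Y x) x) = 0"
        using arg_cong[OF cinner_commute[of "Y x" x], of Im] Ysym[of x x] by simp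
      moreover have "Re (cinner (Y x) x) \<le> (norm x)\<^sup>2"
      proof -
        have "Re (cinner (Y x) x) \<le> norm (Y x) * norm x"
          using norm_cinner_le complex_Re_le_cmod order_trans by blast
        also have "\<dots> \<le> norm x * norm x"
          by (intro mult_right_mono Ybound) auto
        finally show ?thesis
          by (simp add: power2_eq_square)
      qed
      ultimately show "cinner (x - Y x) x \<in> \<real>\<^sub>\<ge>\<^sub>0"
        by (simp add: complex_nonneg_Reals_iff cinner_diff_left cinner_self del: of_real_power)
    qed
    show "x - Y x - Y (x - Y x) = x - B x" for x
    proof -
      have "2 *\<^sub>R Y x = B x + Y (Y x)"
        by (subst Ysq) simp
      then show ?thesis
        by (simp add: bounded_clinear_diff[OF Ylin] scaleR_2 algebra_simps)
    qed
    show "C (x - Y x) = C x - Y (C x)"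
      if C: "bounded_clinear C" "\<And>x. C (B x) = B (C x)" for C x
    proof -
      have "(\<lambda>n. C (?Y n x)) \<longlonglongrightarrow> C (Y x)"
        by (rule bounded_linear.tendsto[OF bounded_clinear_bounded_linear[OF C(1)] Y])
      then have "C (Y x) = Y (C x)"
        unfolding comm[OF C] by (rule LIMSEQ_unique) (rule Y)
      then show ?thesis
        by (simp add: bounded_clinear_diff[OF C(1)])
    qed
  qed
qed

text \<open>Any root \<open>R\<close> commutes with \<open>B\<close>, since \<open>R\<close>
  commutes with its own square, and hence with the constructed root \<open>S\<close>. Then
  \<open>S + R\<close> kills \<open>y = S x - R x\<close>. As both forms are nonnegative,
  \<open>S\<close> and \<open>R\<close> each kill \<open>y\<close>, and self-adjointness makes
  \<open>y\<close> orthogonal to itself.\<close>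

lemma positive_sqrt_unique:
  fixes B :: "'a::complex_hilbert \<Rightarrow> 'a"
  assumes B: "bounded_clinear B" "\<And>x y. cinner (B x) y = cinner x (B y)"
    "\<And>x. norm (B x) \<le> norm x"
    and R: "positive_op R" "\<And>x. R (R x) = x - B x"
    and R': "positive_op R'" "\<And>x. R' (R' x) = x - B x"
  shows "R = R'"
proof -
  obtain S where S: "positive_op S" "\<And>x. S (S x) = x - B x"
    and comm: "\<And>C x. bounded_clinear C \<Longrightarrow> (\<And>x. C (B x) = B (C x)) \<Longrightarrow> C (S x) = S (C x)"
    using positive_sqrt_exists[OF B] by metis
  have "R = S" if R: "positive_op R" "\<And>x. R (R x) = x - B x" for R
  proof
    fix x
    note Rlin = positive_op_bounded_clinear[OF R(1)] and Slin = positive_op_bounded_clinear[OF S(1)]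
    have "R (B z) = B (R z)" for z
    proof -
      have "R z - B (R z) = R (z - B z)"
        unfolding R(2)[symmetric] ..
      then show ?thesis
        by (simp add: bounded_clinear_diff[OF Rlin])
    qed
    then have RS: "R (S z) = S (R z)" for z
      by (rule comm[OF Rlin])
    define y where "y = S x - R x"
    have "S y + R y = 0"
      by (simp add: y_def bounded_clinear_diff[OF Rlin] bounded_clinear_diff[OF Slin] RS R S)
    then have "cinner (S y) y + cinner (R y) y = 0"
      by (metis cinner_add_left cinner_zero_left)
    then have "cinner (S y) y = 0" "cinner (R y) y = 0"
      using positive_op_nonneg[OF S(1), of y] positive_op_nonneg[OF R(1), of y]
      by (auto simp: complex_eq_iff)
    then have "S y = 0" "R y = 0"
      using positive_op_eq_0 S R by blast+
    then have "cinner (S x - R x) y = 0"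
      by (simp add: cinner_diff_left positive_op_self_adjoint[OF S(1)]
          positive_op_self_adjoint[OF R(1)])
    then show "R x = S x"
      by (simp add: y_def[symmetric] cinner_self del: of_real_power) (simp add: y_def)
  qed
  then show ?thesis
    using R R' by blast
qed

section \<open>Defect operators of contractions\<close>

lemma norm_cadjoint_contraction:
  assumes "contraction A"
  shows "norm (cadjoint A x) \<le> norm x"
  using norm_cadjoint_le[of A 1 x] assms by (simp add: contraction_iff)

lemma contraction_cadjoint: "contraction A \<Longrightarrow> contraction (cadjoint A)"
  using norm_cadjoint_contraction
  by (auto simp: contraction_iff bounded_clinear_cadjoint)

lemma
  assumes A: "contraction A"
  shows positive_defect_op: "positive_op (defect_op A)"
    and defect_op_defect_op: "defect_op A (defect_op A x) = x - cadjoint A (A x)"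
    and defect_op_eqI:
      "positive_op R \<Longrightarrow> (\<And>x. R (R x) = x - cadjoint A (A x)) \<Longrightarrow> defect_op A = R"
proof -
  have lin: "bounded_clinear A"
    using A by (simp add: contraction_iff)
  define B where "B x = cadjoint A (A x)" for x
  have B: "bounded_clinear B" "\<And>x y. cinner (B x) y = cinner x (B y)"
    "\<And>x. norm (B x) \<le> norm x"
  proof -
    show "bounded_clinear B"
      unfolding B_def by (rule bounded_clinear_compose[OF bounded_clinear_cadjoint[OF lin] lin])
    show "cinner (B x) y = cinner x (B y)" for x y
      by (simp add: B_def cinner_cadjoint_left[OF lin] cinner_cadjoint_right[OF lin])
    show "norm (B x) \<le> norm x" for x
      unfolding B_def using norm_cadjoint_contraction[OF A, of "A x"] A
      by (metis contraction_iff order_trans)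
  qed
  have eqI: "defect_op A = R" if "positive_op R" "\<And>x. R (R x) = x - cadjoint A (A x)" for R
    unfolding defect_op_def sqrt_op_def
  proof (rule the_equality)
    show "positive_op R \<and> R \<circ> R = (\<lambda>x. x - cadjoint A (A x))"
      using that by (auto simp: o_def)
    show "S = R" if "positive_op S \<and> S \<circ> S = (\<lambda>x. x - cadjoint A (A x))" for S
    proof (rule positive_sqrt_unique[OF B])
      show "S (S x) = x - B x" for x
        using that by (metis B_def comp_apply)
    qed (use that \<open>positive_op R\<close> \<open>\<And>x. R (R x) = _\<close> in \<open>auto simp: B_def\<close>)
  qed
  then show "positive_op R \<Longrightarrow> (\<And>x. R (R x) = x - cadjoint A (A x)) \<Longrightarrow> defect_op A = R"
    by blast
  obtain S where S: "positive_op S" "\<And>x. S (S x) = x - B x"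
    using positive_sqrt_exists[OF B] by metis
  moreover from this have "defect_op A = S"
    by (intro eqI) (auto simp: B_def)
  ultimately show "positive_op (defect_op A)" "defect_op A (defect_op A x) = x - cadjoint A (A x)"
    by (auto simp: B_def)
qed

lemma norm_defect_op_square:
  assumes A: "contraction A"
  shows "(norm (defect_op A x))\<^sup>2 = (norm x)\<^sup>2 - (norm (A x))\<^sup>2"
proof -
  have lin: "bounded_clinear A"
    using A by (simp add: contraction_iff)
  have "cinner (defect_op A x) (defect_op A x) = cinner (x - cadjoint A (A x)) x"
    by (metis A positive_defect_op positive_op_self_adjoint defect_op_defect_op)
  then have "cinner (defect_op A x) (defect_op A x) = cinner x x - cinner (A x) (A x)"
    by (simp add: cinner_diff_left cinner_cadjoint_left[OF lin])
  then show ?thesis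
    by (metis Re_cinner_self minus_complex.simps(1))
qed

section \<open>Neumann series\<close>

lemma neumann_inverse:
  fixes A :: "'a::complex_hilbert \<Rightarrow> 'a"
  assumes A: "bounded_clinear A" and q: "\<And>x. norm (A x) \<le> q * norm x" "0 \<le> q" "q < 1"
  obtains E where "bounded_clinear E" "\<And>x. E x - A (E x) = x" "\<And>x. E (x - A x) = x"
proof -
  have pw: "norm ((A ^^ n) x) \<le> q ^ n * norm x" for n x
  proof (induction n)
    case (Suc n)
    have "norm (A ((A ^^ n) x)) \<le> q * norm ((A ^^ n) x)"
      by (rule q)
    also have "\<dots> \<le> q * (q ^ n * norm x)"
      by (intro mult_left_mono Suc q)
    finally show ?case
      by (simp add: mult_ac)
  qed simp
  have geo: "(\<lambda>n. q ^ n * norm x) sums (norm x * (1 / (1 - q)))" for x :: 'a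
    using sums_mult[OF geometric_sums[of q], of "norm x"] q by (simp add: mult.commute)
  have ns: "summable (\<lambda>n. norm ((A ^^ n) x))" for x
    by (rule summable_comparison_test'[OF sums_summable[OF geo[of x]], of 0]) (simp add: pw)
  then have summ: "summable (\<lambda>n. (A ^^ n) x)" for x
    by (rule summable_norm_cancel)
  define E where "E x = (\<Sum>n. (A ^^ n) x)" for x
  have Alin: "bounded_linear A"
    by (rule bounded_clinear_bounded_linear[OF A])
  have AE: "A (E x) = (\<Sum>n. (A ^^ Suc n) x)" for x
    unfolding E_def using bounded_linear.suminf[OF Alin summ] by simp
  have EA: "E (A x) = (\<Sum>n. (A ^^ Suc n) x)" for x
    unfolding E_def by (simp add: funpow_swap1)
  have split: "(\<Sum>n. (A ^^ Suc n) x) = E x - x" for x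
    unfolding E_def using suminf_split_head[OF summ[of x]] by simp
  have Elin: "bounded_clinear E"
  proof (rule bounded_clinearI)
    show "E (x + y) = E x + E y" for x y
      unfolding E_def
      by (simp add: suminf_add[OF summ summ] bounded_clinear_add[OF bounded_clinear_funpow[OF A]])
    show "E (c *\<^sub>C x) = c *\<^sub>C E x" for c x
      unfolding E_def
      using bounded_linear.suminf[OF bounded_clinear_bounded_linear[OF
        bounded_clinear_const_scaleC[OF bounded_clinear_id, of c]] summ[of x]]
      by (simp add: bounded_clinear_scaleC[OF bounded_clinear_funpow[OF A]])
    show "norm (E x) \<le> norm x * (1 / (1 - q))" for x
    proof -
      have "norm (E x) \<le> (\<Sum>n. norm ((A ^^ n) x))"
        unfolding E_def by (rule summable_norm[OF ns])
      also have "\<dots> \<le> (\<Sum>n. q ^ n * norm x)"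
        by (intro suminf_le pw ns sums_summable[OF geo])
      also have "\<dots> = norm x * (1 / (1 - q))"
        by (rule sums_unique[OF geo, symmetric])
      finally show ?thesis .
    qed
  qed
  show ?thesis
  proof (rule that[OF Elin])
    show "E x - A (E x) = x" for x
      by (simp only: AE split) simp
    show "E (x - A x) = x" for x
      by (simp only: bounded_clinear_diff[OF Elin] EA split) simp
  qed
qed

section \<open>Averages over roots of unity\<close>

text \<open>A geometric sum with ratio \<open>cis t\<close>. Both exponents lie below
  \<open>N\<close> to exclude aliasing: otherwise they could be congruent modulo \<open>N\<close>
  without being equal.\<close>

lemma sum_roots_of_unity:
  assumes "m < N" "l < N"
  shows "(\<Sum>j<N. cis (2 * pi * real j / real N) ^ m * cnj (cis (2 * pi * real j / real N)) ^ l)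
    = (if m = l then of_nat N else 0)"
proof -
  define t where "t = 2 * pi * (real m - real l) / N"
  have eq: "cis (2 * pi * real j / real N) ^ m * cnj (cis (2 * pi * real j / real N)) ^ l = cis t ^ j"
    for j :: nat
  proof -
    have "real m * (2 * pi * real j / real N) + real l * - (2 * pi * real j / real N) = real j * t"
      by (simp add: t_def algebra_simps diff_divide_distrib)
    then show ?thesis
      by (simp only: cis_cnj Complex.DeMoivre cis_mult)
  qed
  show ?thesis
  proof (cases "m = l")
    case False
    have "cis t \<noteq> 1"
    proof
      assume "cis t = 1"
      then have "cos t = 1"
        by (simp add: complex_eq_iff)
      then obtain n :: int where "t = n * 2 * pi"
        using cos_one_2pi_int by auto
      then have "2 * pi * (real m - real l) = 2 * pi * (real_of_int n * real N)"
        using assms by (simp add: t_def field_simps)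
      then have "real m - real l = real_of_int n * real N"
        by (subst (asm) mult_cancel_left) simp
      then have "real_of_int (int m - int l) = real_of_int (n * int N)"
        by simp
      then have nN: "int m - int l = n * int N"
        by (simp only: of_int_eq_iff)
      then have "n \<noteq> 0"
        using False by auto
      then have "int N \<le> \<bar>n * int N\<bar>"
        by (simp add: abs_mult mult_le_cancel_right1) linarith
      then show False
        using assms nN by linarith
    qed
    moreover have "cis t ^ N = 1"
    proof -
      have "real N * t = 2 * pi * of_int (int m - int l)"
        using assms by (simp add: t_def)
      then show ?thesis
        unfolding Complex.DeMoivre by (simp only: cis_multiple_2pi Ints_of_int)
    qed
    ultimately show ?thesis
      unfolding eq using False geometric_sum[of "cis t" N] by simp
  qed (use eq in \<open>simp add: t_def\<close>)
qed

text \<open>A discrete Parseval identity: conjugate powers pair with equal powers only, so sampling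
  at more than \<open>n\<close> nodes computes the circle integral exactly.\<close>

lemma sum_roots_of_unity_cnj_poly_mult:
  fixes \<alpha> \<beta> :: "nat \<Rightarrow> complex"
  assumes "d \<le> n" "n < N"
  shows "(\<Sum>j<N. (\<Sum>k\<le>d. \<alpha> k * cnj (cis (2 * pi * real j / real N)) ^ k) *
      (\<Sum>l\<le>n. \<beta> l * cis (2 * pi * real j / real N) ^ l))
    = of_nat N * (\<Sum>k\<le>d. \<alpha> k * \<beta> k)"
proof -
  let ?w = "\<lambda>j. cis (2 * pi * real j / real N)"
  have "(\<Sum>j<N. (\<Sum>k\<le>d. \<alpha> k * cnj (?w j) ^ k) * (\<Sum>l\<le>n. \<beta> l * ?w j ^ l))
      = (\<Sum>j<N. \<Sum>k\<le>d. \<Sum>l\<le>n. \<alpha> k * \<beta> l * (?w j ^ l * cnj (?w j) ^ k))"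
    unfolding sum_product by (intro sum.cong refl) (simp add: mult_ac)
  also have "\<dots> = (\<Sum>k\<le>d. \<Sum>l\<le>n. \<Sum>j<N. \<alpha> k * \<beta> l * (?w j ^ l * cnj (?w j) ^ k))"
    by (subst sum.swap) (rule sum.cong[OF refl], rule sum.swap)
  also have "\<dots> = (\<Sum>k\<le>d. \<Sum>l\<le>n. \<alpha> k * \<beta> l * (if l = k then of_nat N else 0))"
    unfolding sum_distrib_left[symmetric]
    using assms by (intro sum.cong refl) (subst sum_roots_of_unity, auto)
  also have "\<dots> = (\<Sum>k\<le>d. of_nat N * (\<alpha> k * \<beta> k))"
    using assms by (intro sum.cong refl) (simp add: if_distrib sum.delta cong: if_cong)
  finally show ?thesis
    by (simp add: sum_distrib_left)
qed

text \<open>Both factors are analytic, so the frequencies are the sums \<open>k + l\<close> and only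
  0 survives. The node count must now exceed the total degree.\<close>

lemma sum_roots_of_unity_poly_mult:
  fixes \<alpha> \<beta> :: "nat \<Rightarrow> complex"
  assumes "d + n < N"
  shows "(\<Sum>j<N. (\<Sum>k\<le>d. \<alpha> k * cis (2 * pi * real j / real N) ^ k) *
      (\<Sum>l\<le>n. \<beta> l * cis (2 * pi * real j / real N) ^ l))
    = of_nat N * (\<alpha> 0 * \<beta> 0)"
proof -
  let ?w = "\<lambda>j. cis (2 * pi * real j / real N)"
  have "(\<Sum>j<N. (\<Sum>k\<le>d. \<alpha> k * ?w j ^ k) * (\<Sum>l\<le>n. \<beta> l * ?w j ^ l))
      = (\<Sum>j<N. \<Sum>k\<le>d. \<Sum>l\<le>n. \<alpha> k * \<beta> l * (?w j ^ (k + l) * cnj (?w j) ^ 0))"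
    unfolding sum_product by (intro sum.cong refl) (simp add: mult_ac power_add)
  also have "\<dots> = (\<Sum>k\<le>d. \<Sum>l\<le>n. \<Sum>j<N. \<alpha> k * \<beta> l * (?w j ^ (k + l) * cnj (?w j) ^ 0))"
    by (subst sum.swap) (rule sum.cong[OF refl], rule sum.swap)
  also have "\<dots> = (\<Sum>k\<le>d. \<Sum>l\<le>n. \<alpha> k * \<beta> l * (if k + l = 0 then of_nat N else 0))"
    unfolding sum_distrib_left[symmetric]
    using assms by (intro sum.cong refl) (subst sum_roots_of_unity, auto)
  also have "\<dots> = (\<Sum>k\<le>d. if k = 0 then \<Sum>l\<le>n. if l = 0 then of_nat N * (\<alpha> 0 * \<beta> 0) else 0 else 0)"
    by (intro sum.cong refl) (auto simp: if_distrib[of "\<lambda>x. _ * x"] mult_ac cong: if_cong)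
  finally show ?thesis
    by simp
qed

text \<open>The coefficients of the Poisson kernel \<open>(1 + u) / (1 - u) = 1 + 2u + 2u\<^sup>2 + \<dots>\<close>, whose
  real part is positive on the disc.\<close>

definition poisson_coeff :: "nat \<Rightarrow> 'a::comm_ring_1" where
  "poisson_coeff k = (if k = 0 then 1 else 2)"

lemma sum_poisson_coeff:
  fixes f :: "nat \<Rightarrow> 'a::comm_ring_1"
  shows "(\<Sum>k\<le>n. poisson_coeff k * f k) = 2 * (\<Sum>k\<le>n. f k) - f 0"
  by (induction n) (auto simp: poisson_coeff_def algebra_simps)

text \<open>The truncated series is the full kernel \<open>(1 + u) / (1 - u)\<close>, whose real
  part is nonnegative, minus the tail \<open>2 * u ^ Suc n / (1 - u)\<close>; the lower bound
  estimates that tail.\<close>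

lemma Re_truncated_poisson_ge:
  assumes "cmod u \<le> r" "0 < r" "r < 1"
  shows "- (2 * r ^ Suc n / (1 - r)) \<le> Re (\<Sum>k\<le>n. poisson_coeff k * u ^ k)"
proof -
  have u1: "u \<noteq> 1"
    using assms by auto
  have lower: "1 - r \<le> cmod (1 - u)"
    using norm_triangle_ineq2[of 1 u] assms by simp
  have geo: "(\<Sum>k\<le>n. u ^ k) = (1 - u ^ Suc n) / (1 - u)"
    using u1 sum_gp_basic[of u n] by (simp add: field_simps)
  have eq: "(\<Sum>k\<le>n. poisson_coeff k * u ^ k) = (1 + u) / (1 - u) - 2 * u ^ Suc n / (1 - u)"
  proof -
    have "2 * ((1 - v) / (1 - u)) - 1 = (1 + u) / (1 - u) - 2 * v / (1 - u)" for v
      using u1 by (simp add: diff_divide_eq_iff eq_divide_eq divide_diff_eq_iff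
          diff_divide_distrib[symmetric])
    then show ?thesis
      by (simp add: geo sum_poisson_coeff)
  qed
  have "Re ((1 + u) / (1 - u)) = (1 - (cmod u)\<^sup>2) / (cmod (1 - u))\<^sup>2"
    unfolding Re_divide cmod_power2 by (simp add: algebra_simps power2_eq_square)
  moreover have "(cmod u)\<^sup>2 \<le> 1"
    using assms by (intro power_le_one) auto
  ultimately have 1: "0 \<le> Re ((1 + u) / (1 - u))"
    by simp
  have "Re (2 * u ^ Suc n / (1 - u)) \<le> cmod (2 * u ^ Suc n / (1 - u))"
    by (rule complex_Re_le_cmod)
  also have "\<dots> = 2 * cmod u ^ Suc n / cmod (1 - u)"
    by (simp add: norm_divide norm_mult norm_power)
  also have "\<dots> \<le> 2 * r ^ Suc n / (1 - r)"
    using assms lower by (intro frac_le mult_left_mono power_mono) auto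
  finally show ?thesis
    using 1 unfolding eq by simp
qed

text \<open>A discrete form of integrating \<open>Re p\<close> against a positive harmonic function.
  The hypothesis says that the series with moments \<open>a\<close> has nonnegative real part up to
  a truncation error; the pairing is the circle average of a product of two nonnegative functions,
  first on radius \<open>r\<close> and then in the limit at 1.\<close>

lemma Re_poly_pairing_nonneg:
  fixes a :: "nat \<Rightarrow> complex"
  assumes p: "\<And>z. cmod z \<le> 1 \<Longrightarrow> 0 \<le> Re (poly p z)" and a0: "Im (a 0) = 0"
    and a: "\<And>r. 0 < r \<Longrightarrow> r < 1 \<Longrightarrow> \<exists>e. e \<longlonglongrightarrow> 0 \<and>
      (\<forall>n z. cmod z = r \<longrightarrow> - e n \<le> Re (\<Sum>k\<le>n. poisson_coeff k * a k * z ^ k))"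
  shows "0 \<le> Re (\<Sum>k\<le>degree p. coeff p k * a k)"
proof -
  let ?d = "degree p"
  have r_case: "0 \<le> Re (\<Sum>k\<le>?d. coeff p k * (a k * of_real r ^ k))"
    if r: "0 < r" "r < 1" for r :: real
  proof -
    obtain e where e: "e \<longlonglongrightarrow> 0"
      and ge: "\<And>n z. cmod z = r \<Longrightarrow> - e n \<le> Re (\<Sum>k\<le>n. poisson_coeff k * a k * z ^ k)"
      using a[OF r] by blast
    define s where "s = (\<Sum>k\<le>?d. coeff p k * (a k * of_real r ^ k))"
    have "0 \<le> Re s + e n * Re (coeff p 0)" if n: "?d \<le> n" for n
    proof -
      define N where "N = ?d + n + 1"
      define w where "w j = cis (2 * pi * real j / real N)" for j :: nat
      define b where "b k = poisson_coeff k * a k * of_real r ^ k" for k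
      define P where "P j = (\<Sum>k\<le>?d. coeff p k * cnj (w j) ^ k)" for j
      define G where "G j = (\<Sum>k\<le>n. b k * w j ^ k)" for j
      have "0 \<le> Re (P j) * (Re (G j) + e n)" for j
      proof (rule mult_nonneg_nonneg)
        have "P j = poly p (cnj (w j))"
          by (simp add: P_def poly_altdef)
        then show "0 \<le> Re (P j)"
          using p[of "cnj (w j)"] by (simp add: w_def)
        have "G j = (\<Sum>k\<le>n. poisson_coeff k * a k * (of_real r * w j) ^ k)"
          by (simp add: G_def b_def power_mult_distrib mult_ac)
        then show "0 \<le> Re (G j) + e n"
          using ge[of "of_real r * w j" n] r by (simp add: w_def norm_mult)
      qed
      then have "0 \<le> (\<Sum>j<N. Re (P j) * (Re (G j) + e n))"
        by (intro sum_nonneg)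
      \<comment> \<open>The product of real parts is split so that \<open>P * G\<close> pairs equal
        frequencies, while \<open>cnj P * G\<close> is analytic and leaves only its constant
        term.\<close>
      also have "\<dots> = (\<Sum>j<N. Re (P j * G j + cnj (P j) * G j) / 2 + e n * Re (P j * 1))"
        by (intro sum.cong refl) (simp add: algebra_simps)
      also have "\<dots> = Re ((\<Sum>j<N. P j * G j) + (\<Sum>j<N. cnj (P j) * G j)) / 2
          + e n * Re (\<Sum>j<N. P j * 1)"
        by (simp only: sum.distrib sum_divide_distrib[symmetric] sum_distrib_left[symmetric]
            Re_sum[symmetric])
      also have "(\<Sum>j<N. P j * G j) = of_nat N * (\<Sum>k\<le>?d. coeff p k * b k)"
        unfolding P_def G_def w_def
        using n by (intro sum_roots_of_unity_cnj_poly_mult) (auto simp: N_def)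
      also have "(\<Sum>j<N. cnj (P j) * G j) = of_nat N * (cnj (coeff p 0) * b 0)"
      proof -
        have "cnj (P j) = (\<Sum>k\<le>?d. cnj (coeff p k) * w j ^ k)" for j
          by (simp add: P_def)
        then show ?thesis
          unfolding G_def w_def
          using sum_roots_of_unity_poly_mult[of ?d n N "\<lambda>k. cnj (coeff p k)" b]
          by (simp add: N_def)
      qed
      also have "(\<Sum>j<N. P j * 1) = of_nat N * coeff p 0"
      proof -
        \<comment> \<open>The constant 1 is written as a polynomial of formal degree
          \<open>n\<close> so that the same Parseval identity applies.\<close>
        have "(\<Sum>j<N. P j * 1) = (\<Sum>j<N. P j * (\<Sum>l\<le>n. (if l = 0 then 1 else 0) * w j ^ l))"
          by (simp add: if_distrib[of "\<lambda>x. x * _"] cong: if_cong)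
        also have "\<dots> = of_nat N * (\<Sum>k\<le>?d. coeff p k * (if k = 0 then 1 else 0))"
          unfolding P_def w_def
          using n by (intro sum_roots_of_unity_cnj_poly_mult) (auto simp: N_def)
        finally show ?thesis
          by (simp add: if_distrib[of "\<lambda>x. _ * x"] cong: if_cong)
      qed
      \<comment> \<open>The weight of index 0 is 1 rather than 2. The constant term of
        \<open>cnj P * G\<close> supplies the missing half, since \<open>a 0\<close> is
        real.\<close>
      also have "Re (of_nat N * (\<Sum>k\<le>?d. coeff p k * b k) + of_nat N * (cnj (coeff p 0) * b 0)) / 2
          + e n * Re (of_nat N * coeff p 0) = N * (Re s + e n * Re (coeff p 0))"
      proof -
        have "(\<Sum>k\<le>?d. coeff p k * b k)
            = (\<Sum>k\<le>?d. poisson_coeff k * (coeff p k * (a k * of_real r ^ k)))"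
          by (intro sum.cong refl) (simp add: b_def mult_ac)
        also have "\<dots> = 2 * s - coeff p 0 * a 0"
          by (simp add: sum_poisson_coeff s_def)
        finally have eq: "(\<Sum>k\<le>?d. coeff p k * b k) = 2 * s - coeff p 0 * a 0" .
        have "b 0 = a 0"
          by (simp add: b_def poisson_coeff_def)
        then show ?thesis
          unfolding eq using a0 by (simp add: algebra_simps)
      qed
      finally show ?thesis
        by (simp add: zero_le_mult_iff N_def)
    qed
    moreover have "(\<lambda>n. Re s + e n * Re (coeff p 0)) \<longlonglongrightarrow> Re s + 0 * Re (coeff p 0)"
      by (intro tendsto_intros e)
    ultimately have "0 \<le> Re s + 0 * Re (coeff p 0)"
      by (intro LIMSEQ_le_const) auto
    then show ?thesis
      by (simp add: s_def)
  qed
  have "((\<lambda>r. Re (\<Sum>k\<le>?d. coeff p k * (a k * of_real r ^ k)))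
      \<longlongrightarrow> Re (\<Sum>k\<le>?d. coeff p k * (a k * of_real 1 ^ k))) (at_left 1)"
    by (intro tendsto_intros)
  moreover have "\<forall>\<^sub>F r in at_left 1. 0 \<le> Re (\<Sum>k\<le>?d. coeff p k * (a k * of_real r ^ k))"
    by (rule eventually_mono[OF eventually_at_left_real[of 0 "1::real"]])
      (auto simp del: Re_sum intro: r_case)
  ultimately show ?thesis
    using tendsto_lowerbound[of _ _ "at_left (1::real)" 0] by simp
qed

section \<open>Harnack domination\<close>

lemma bounded_clinear_poly_op: "bounded_clinear A \<Longrightarrow> bounded_clinear (poly_op p A)"
  unfolding poly_op_def by (intro bounded_clinear_intros)

lemma bounded_clinear_op_Re: "bounded_clinear A \<Longrightarrow> bounded_clinear (op_Re A)"
  unfolding op_Re_def by (intro bounded_clinear_intros bounded_clinear_cadjoint)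

lemma cinner_op_Re:
  assumes "bounded_clinear A"
  shows "cinner (op_Re A x) x = of_real (Re (cinner (A x) x))"
proof -
  have "cinner (op_Re A x) x = (cinner (A x) x + cnj (cinner (A x) x)) / 2"
    using cinner_commute[of x "A x"]
    by (simp add: op_Re_def cinner_distribs cinner_cadjoint_left[OF assms])
  then show ?thesis
    by (simp add: complex_eq_iff)
qed

lemma cinner_poly_op:
  "cinner (poly_op p A x) y = (\<Sum>i\<le>degree p. coeff p i * cinner ((A ^^ i) x) y)"
  by (simp add: poly_op_def cinner_sum_left cinner_scaleC_left)

lemma op_le_op_Re_iff:
  assumes A: "bounded_clinear A" and B: "bounded_clinear B"
  shows "op_le (op_Re A) (\<lambda>x. c *\<^sub>R op_Re B x)
    \<longleftrightarrow> (\<forall>x. Re (cinner (A x) x) \<le> c * Re (cinner (B x) x))"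
proof -
  have "bounded_clinear (\<lambda>x. c *\<^sub>R op_Re B x - op_Re A x)"
    by (intro bounded_clinear_intros bounded_clinear_op_Re A B)
  moreover have "cinner (c *\<^sub>R op_Re B x - op_Re A x) x
      = of_real (c * Re (cinner (B x) x) - Re (cinner (A x) x))" for x
    by (simp add: cinner_diff_left cinner_scaleR_left cinner_op_Re A B)
  ultimately show ?thesis
    unfolding op_le_def positive_op_def by (simp del: of_real_mult of_real_diff)
qed

text \<open>The order on real parts sees only real quadratic forms, so adjoints disappear and
  domination becomes a scalar inequality at each vector.\<close>

lemma harnack_dominated_iff:
  assumes S: "bounded_clinear S" and T: "bounded_clinear T"
  shows "harnack_dominated S T \<longleftrightarrow> (\<exists>c\<ge>1. \<forall>p. (\<forall>z. cmod z \<le> 1 \<longrightarrow> 0 \<le> Re (poly p z)) \<longrightarrow>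
    (\<forall>x. Re (\<Sum>i\<le>degree p. coeff p i * cinner ((S ^^ i) x) x)
      \<le> c * Re (\<Sum>i\<le>degree p. coeff p i * cinner ((T ^^ i) x) x)))"
  unfolding harnack_dominated_def op_le_op_Re_iff[OF bounded_clinear_poly_op[OF S]
    bounded_clinear_poly_op[OF T]] cinner_poly_op by blast

text \<open>The scalar inequality only compares the two forms at one vector \<open>x\<close>. Applied to the rotated
  Poisson polynomials \<open>z \<mapsto> p (w z)\<close> at \<open>x = h + cnj w g\<close> and averaged over the roots of unity \<open>w\<close>,
  it decouples \<open>g\<close> and \<open>h\<close>.\<close>

lemma harnack_dominated_quadratic:
  assumes S: "bounded_clinear S" and T: "bounded_clinear T" and "harnack_dominated S T"
  obtains c where "1 \<le> c" "\<And>g h. (norm g)\<^sup>2 + (norm h)\<^sup>2 + 2 * Re (cinner (S g) h)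
    \<le> c * ((norm g)\<^sup>2 + (norm h)\<^sup>2 + 2 * Re (cinner (T g) h))"
proof -
  obtain c where c: "1 \<le> c" and dom: "\<And>p x. (\<And>z. cmod z \<le> 1 \<Longrightarrow> 0 \<le> Re (poly p z)) \<Longrightarrow>
      Re (\<Sum>i\<le>degree p. coeff p i * cinner ((S ^^ i) x) x)
      \<le> c * Re (\<Sum>i\<le>degree p. coeff p i * cinner ((T ^^ i) x) x)"
    using assms(3) unfolding harnack_dominated_iff[OF S T] by blast
  define D where "D i x y = of_real c * cinner ((T ^^ i) x) y - cinner ((S ^^ i) x) y" for i x y
  have D_expand: "D i (h + cnj w *\<^sub>C g) (h + cnj w *\<^sub>C g)
      = D i h h + D i g g + w * D i h g + cnj w * D i g h"
    if "cmod w = 1" for i h g w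
  proof -
    have "w * cnj w = 1"
      using that complex_norm_square[of w] by simp
    then have ww: "w * (cnj w * t) = t" "cnj w * (w * t) = t" for t
      by (simp_all add: mult.assoc[symmetric] mult.commute[of "cnj w"])
    show ?thesis
      by (simp add: D_def cinner_distribs bounded_clinear_add[OF bounded_clinear_funpow[OF S]]
        bounded_clinear_add[OF bounded_clinear_funpow[OF T]]
        bounded_clinear_scaleC[OF bounded_clinear_funpow[OF S]]
        bounded_clinear_scaleC[OF bounded_clinear_funpow[OF T]] algebra_simps ww)
  qed
  have key: "0 \<le> (1 + 2 * r ^ Suc n / (1 - r)) * Re (D 0 h h + D 0 g g) + 2 * r * Re (D 1 g h)"
    if r: "0 < r" "r < 1" and n: "1 \<le> n" for r :: real and n :: nat and g h
  proof -
    \<comment> \<open>\<open>\<epsilon>\<close> bounds the truncation error of the Poisson kernel;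
      added to the constant coefficient it makes the truncated kernel an admissible test
      polynomial.\<close>
    define \<epsilon> where "\<epsilon> = 2 * r ^ Suc n / (1 - r)"
    define a where
      "a k = poisson_coeff k * of_real r ^ k + (if k = 0 then of_real \<epsilon> else 0 :: complex)" for k
    define p where "p w = (\<Sum>k\<le>n. monom (a k * w ^ k) k)" for w
    have coeff_p: "coeff (p w) k = (if k \<le> n then a k * w ^ k else 0)" for w k
      by (auto simp: p_def coeff_sum coeff_monom if_distrib sum.delta cong: if_cong)
    have deg_p: "degree (p w) \<le> n" for w
      by (rule degree_le) (simp add: coeff_p)
    have sum_p: "(\<Sum>i\<le>degree (p w). coeff (p w) i * f i) = (\<Sum>i\<le>n. a i * w ^ i * f i)" for w f
    proof -
      have "(\<Sum>i\<le>degree (p w). coeff (p w) i * f i) = (\<Sum>i\<le>n. coeff (p w) i * f i)"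
        using deg_p[of w] by (intro sum.mono_neutral_left) (auto simp: coeff_eq_0)
      then show ?thesis
        by (simp add: coeff_p)
    qed
    have p_nonneg: "0 \<le> Re (poly (p w) z)" if "cmod z \<le> 1" "cmod w = 1" for w z
    proof -
      let ?u = "of_real r * w * z"
      have "poly (p w) z = (\<Sum>i\<le>n. a i * w ^ i * z ^ i)"
        by (simp add: p_def poly_sum poly_monom)
      also have "\<dots> = (\<Sum>i\<le>n. poisson_coeff i * ?u ^ i) + (\<Sum>i\<le>n. if i = 0 then of_real \<epsilon> else 0)"
        unfolding sum.distrib[symmetric]
        by (intro sum.cong refl) (simp add: a_def power_mult_distrib algebra_simps)
      also have "\<dots> = (\<Sum>i\<le>n. poisson_coeff i * ?u ^ i) + of_real \<epsilon>"
        by simp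
      finally have "Re (poly (p w) z) = Re (\<Sum>i\<le>n. poisson_coeff i * ?u ^ i) + \<epsilon>"
        by simp
      moreover have "cmod ?u \<le> r"
        using that r by (simp add: norm_mult mult_left_le)
      ultimately show ?thesis
        using Re_truncated_poisson_ge[of ?u r n] r by (simp add: \<epsilon>_def)
    qed
    \<comment> \<open>The rotated vector contributes one extra power of \<open>w\<close>, so
      exponents reach \<open>n + 1\<close> and must stay below \<open>N\<close>.\<close>
    define N where "N = n + 2"
    define w where "w j = cis (2 * pi * real j / real N)" for j :: nat
    define m where "m i j = a i * w j ^ i *
        (D i h h + D i g g + w j * D i h g + cnj (w j) * D i g h)" for i j
    have "0 \<le> Re (\<Sum>i\<le>n. m i j)" for j
    proof -
      let ?x = "h + cnj (w j) *\<^sub>C g"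
      have w1: "cmod (w j) = 1"
        by (simp add: w_def)
      have "Re (\<Sum>i\<le>n. a i * w j ^ i * cinner ((S ^^ i) ?x) ?x)
          \<le> c * Re (\<Sum>i\<le>n. a i * w j ^ i * cinner ((T ^^ i) ?x) ?x)"
        using dom[of "p (w j)" ?x] p_nonneg w1 unfolding sum_p by blast
      moreover have "(\<Sum>i\<le>n. a i * w j ^ i * D i ?x ?x)
          = of_real c * (\<Sum>i\<le>n. a i * w j ^ i * cinner ((T ^^ i) ?x) ?x)
            - (\<Sum>i\<le>n. a i * w j ^ i * cinner ((S ^^ i) ?x) ?x)"
        by (simp add: D_def right_diff_distrib sum_subtractf sum_distrib_left mult_ac)
      ultimately have "0 \<le> Re (\<Sum>i\<le>n. a i * w j ^ i * D i ?x ?x)"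
        by simp
      then show ?thesis
        by (simp only: D_expand[OF w1] m_def)
    qed
    then have "0 \<le> (\<Sum>j<N. Re (\<Sum>i\<le>n. m i j))"
      by (intro sum_nonneg)
    also have "\<dots> = Re (\<Sum>i\<le>n. \<Sum>j<N. m i j)"
      unfolding Re_sum[symmetric] by (subst sum.swap) (rule refl)
    also have "(\<Sum>i\<le>n. \<Sum>j<N. m i j)
        = (\<Sum>i\<le>n. a i * of_nat N *
            ((if i = 0 then D 0 h h + D 0 g g else 0) + (if i = 1 then D 1 g h else 0)))"
    proof (rule sum.cong[OF refl])
      fix i assume "i \<in> {..n}"
      then have i: "i < N" "i + 1 < N" "0 < N" "1 < N"
        by (auto simp: N_def)
      \<comment> \<open>Averaging keeps the diagonal terms for \<open>i = 0\<close> only, never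
        keeps \<open>D i h g\<close> because its frequency is \<open>i + 1\<close>, and keeps
        \<open>D i g h\<close> for \<open>i = 1\<close> only. Hence just the first powers of
        \<open>S\<close> and \<open>T\<close> remain.\<close>
      have "(\<Sum>j<N. m i j)
          = a i * (D i h h + D i g g) * (\<Sum>j<N. w j ^ i * cnj (w j) ^ 0)
          + a i * D i h g * (\<Sum>j<N. w j ^ (i + 1) * cnj (w j) ^ 0)
          + a i * D i g h * (\<Sum>j<N. w j ^ i * cnj (w j) ^ 1)"
        unfolding m_def sum_distrib_left sum.distrib[symmetric]
        by (intro sum.cong refl) (simp add: algebra_simps)
      also have "\<dots> = a i * (D i h h + D i g g) * (if i = 0 then of_nat N else 0)
          + a i * D i h g * (if i + 1 = 0 then of_nat N else 0)
          + a i * D i g h * (if i = 1 then of_nat N else 0)"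
        unfolding w_def using i by (simp only: sum_roots_of_unity)
      finally show "(\<Sum>j<N. m i j)
          = a i * of_nat N *
            ((if i = 0 then D 0 h h + D 0 g g else 0) + (if i = 1 then D 1 g h else 0))"
        by auto
    qed
    also have "\<dots> = of_nat N * (a 0 * (D 0 h h + D 0 g g) + a 1 * D 1 g h)"
      using n by (simp add: distrib_left sum.distrib if_distrib[of "\<lambda>x. _ * x"] sum.delta mult_ac
          cong: if_cong)
    also have "Re \<dots> = N * ((1 + \<epsilon>) * Re (D 0 h h + D 0 g g) + 2 * r * Re (D 1 g h))"
      by (simp add: a_def poisson_coeff_def)
    finally show ?thesis
      by (simp add: zero_le_mult_iff N_def \<epsilon>_def)
  qed
  have key2: "0 \<le> Re (D 0 h h + D 0 g g) + 2 * r * Re (D 1 g h)"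
    if r: "0 < r" "r < 1" for r :: real and g h
  proof -
    have "(\<lambda>n. (1 + 2 * r ^ Suc n / (1 - r)) * Re (D 0 h h + D 0 g g) + 2 * r * Re (D 1 g h))
        \<longlonglongrightarrow> (1 + 2 * 0 / (1 - r)) * Re (D 0 h h + D 0 g g) + 2 * r * Re (D 1 g h)"
      using r by (intro tendsto_intros LIMSEQ_Suc[OF LIMSEQ_power_zero]) auto
    then have "0 \<le> (1 + 2 * 0 / (1 - r)) * Re (D 0 h h + D 0 g g) + 2 * r * Re (D 1 g h)"
      by (rule LIMSEQ_le_const) (use key[OF r] in blast)
    then show ?thesis
      by simp
  qed
  have key3: "0 \<le> Re (D 0 h h + D 0 g g) + 2 * 1 * Re (D 1 g h)" for g h
  proof (rule tendsto_lowerbound)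
    show "((\<lambda>r. Re (D 0 h h + D 0 g g) + 2 * r * Re (D 1 g h))
        \<longlongrightarrow> Re (D 0 h h + D 0 g g) + 2 * 1 * Re (D 1 g h)) (at_left 1)"
      by (intro tendsto_intros)
    show "\<forall>\<^sub>F r in at_left 1. 0 \<le> Re (D 0 h h + D 0 g g) + 2 * r * Re (D 1 g h)"
      using eventually_at_left_real[of 0 "1::real"] by (auto elim!: eventually_mono dest: key2)
  qed simp
  show ?thesis
  proof (rule that[OF c])
    show "(norm g)\<^sup>2 + (norm h)\<^sup>2 + 2 * Re (cinner (S g) h)
        \<le> c * ((norm g)\<^sup>2 + (norm h)\<^sup>2 + 2 * Re (cinner (T g) h))" for g h
      using key3[of h g] by (simp add: D_def cinner_self algebra_simps del: of_real_power)
  qed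
qed

text \<open>With \<open>u\<close> the resolvent of \<open>S\<close> at \<open>x\<close>, the
  expression \<open>2 * Re (cinner u x) - (norm x)\<^sup>2\<close> is the operator Poisson kernel of
  \<open>S\<close> at \<open>z\<close> tested on \<open>x\<close>. Stating it through solutions
  \<open>u\<close> and \<open>y\<close> avoids naming inverse operators. The kernel inequality feeds
  \<open>Re_poly_pairing_nonneg\<close> with the moments of \<open>T\<close> times \<open>c\<close>
  minus those of \<open>S\<close>.\<close>

lemma harnack_dominated_if_resolvent_le:
  assumes S: "contraction S" and T: "contraction T" and c: "1 \<le> c"
    and le: "\<And>z x u y. cmod z < 1 \<Longrightarrow> u - z *\<^sub>C S u = x \<Longrightarrow> y - z *\<^sub>C T y = x \<Longrightarrow>
      2 * Re (cinner u x) - (norm x)\<^sup>2 \<le> c * (2 * Re (cinner y x) - (norm x)\<^sup>2)"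
  shows "harnack_dominated S T"
proof -
  have lin: "bounded_clinear S" "bounded_clinear T"
    using S T by (auto simp: contraction_iff)
  have resolvent: "\<exists>u. u - z *\<^sub>C A u = x \<and> (\<forall>n.
      cmod ((\<Sum>k\<le>n. poisson_coeff k * (cinner ((A ^^ k) x) x * z ^ k))
          - (2 * cinner u x - of_real ((norm x)\<^sup>2)))
      \<le> 2 * r ^ Suc n * (norm x)\<^sup>2 / (1 - r))"
    if A: "contraction A" and r: "0 < r" "r < 1" and z: "cmod z = r" for A :: "'a \<Rightarrow> 'a" and r z x
  proof -
    have Alin: "bounded_clinear A" and Anorm: "\<And>x. norm (A x) \<le> norm x"
      using A by (auto simp: contraction_iff)
    obtain E where E: "\<And>x. E x - z *\<^sub>C A (E x) = x"
    proof (rule neumann_inverse[of "\<lambda>x. z *\<^sub>C A x" r])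
      show "bounded_clinear (\<lambda>x. z *\<^sub>C A x)"
        by (intro bounded_clinear_intros Alin)
      show "norm (z *\<^sub>C A x) \<le> r * norm x" for x
        using r Anorm[of x] by (simp add: norm_scaleC z)
    qed (use r in auto)
    define u where "u = E x"
    have u: "u - z *\<^sub>C A u = x"
      by (simp add: u_def E)
    have "norm u \<le> norm x + r * norm u"
    proof -
      have "norm u = norm (x + z *\<^sub>C A u)"
        using u by (simp add: algebra_simps)
      also have "\<dots> \<le> norm x + norm (z *\<^sub>C A u)"
        by (rule norm_triangle_ineq)
      also have "norm (z *\<^sub>C A u) \<le> r * norm u"
        using r Anorm[of u] by (simp add: norm_scaleC z)
      finally show ?thesis
        by simp
    qed
    then have unorm: "norm u \<le> norm x / (1 - r)"
      using r by (simp add: field_simps)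
    have pw: "norm ((A ^^ n) v) \<le> norm v" for n v
      by (induction n) (auto intro: order_trans[OF Anorm])
    \<comment> \<open>The Neumann series is stopped after \<open>n\<close> terms with an exact
      remainder, which is bounded uniformly on the circle of radius \<open>r\<close>.\<close>
    have expand: "cinner u x = (\<Sum>k\<le>n. cinner ((A ^^ k) x) x * z ^ k)
        + z ^ Suc n * cinner ((A ^^ Suc n) u) x" for n
    proof (induction n)
      case 0
      have "u = x + z *\<^sub>C A u"
        using u by (simp add: algebra_simps)
      then show ?case
        by simp (metis cinner_add_left cinner_scaleC_left)
    next
      case (Suc n)
      have "(A ^^ Suc n) u = (A ^^ Suc n) (x + z *\<^sub>C A u)"
        using u by (simp add: algebra_simps del: funpow.simps)
      also have "\<dots> = (A ^^ Suc n) x + z *\<^sub>C (A ^^ Suc (Suc n)) u"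
      proof -
        have "(A ^^ Suc n) (A u) = (A ^^ Suc (Suc n)) u"
          by (simp add: funpow_swap1)
        then show ?thesis
          by (simp only: bounded_clinear_add[OF bounded_clinear_funpow[OF Alin]]
              bounded_clinear_scaleC[OF bounded_clinear_funpow[OF Alin]])
      qed
      finally have "cinner ((A ^^ Suc n) u) x
          = cinner ((A ^^ Suc n) x) x + z * cinner ((A ^^ Suc (Suc n)) u) x"
        by (simp only: cinner_add_left cinner_scaleC_left)
      then show ?case
        unfolding Suc by (simp add: algebra_simps del: funpow.simps)
    qed
    have "cmod ((\<Sum>k\<le>n. poisson_coeff k * (cinner ((A ^^ k) x) x * z ^ k))
          - (2 * cinner u x - of_real ((norm x)\<^sup>2)))
        \<le> 2 * r ^ Suc n * (norm x)\<^sup>2 / (1 - r)" for n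
    proof -
      have "(\<Sum>k\<le>n. poisson_coeff k * (cinner ((A ^^ k) x) x * z ^ k))
          - (2 * cinner u x - of_real ((norm x)\<^sup>2))
          = - (2 * z ^ Suc n * cinner ((A ^^ Suc n) u) x)"
        using expand[of n] by (simp add: sum_poisson_coeff cinner_self del: funpow.simps)
      then have "cmod ((\<Sum>k\<le>n. poisson_coeff k * (cinner ((A ^^ k) x) x * z ^ k))
          - (2 * cinner u x - of_real ((norm x)\<^sup>2)))
          = 2 * r ^ Suc n * cmod (cinner ((A ^^ Suc n) u) x)"
        by (simp add: norm_mult norm_power z del: funpow.simps)
      also have "cmod (cinner ((A ^^ Suc n) u) x) \<le> norm ((A ^^ Suc n) u) * norm x"
        by (rule norm_cinner_le)
      also have "\<dots> \<le> norm x / (1 - r) * norm x"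
        by (intro mult_right_mono order_trans[OF pw unorm]) simp
      finally show ?thesis
        using r by (simp add: power2_eq_square mult_left_mono)
    qed
    then show ?thesis
      using u by blast
  qed
  have "Re (\<Sum>i\<le>degree p. coeff p i * cinner ((S ^^ i) x) x)
      \<le> c * Re (\<Sum>i\<le>degree p. coeff p i * cinner ((T ^^ i) x) x)"
    if p: "\<And>z. cmod z \<le> 1 \<Longrightarrow> 0 \<le> Re (poly p z)" for p x
  proof -
    define a where "a i = of_real c * cinner ((T ^^ i) x) x - cinner ((S ^^ i) x) x" for i
    have "0 \<le> Re (\<Sum>i\<le>degree p. coeff p i * a i)"
    proof (rule Re_poly_pairing_nonneg[OF p])
      show "Im (a 0) = 0"
        by (simp add: a_def cinner_self del: of_real_power)
      fix r :: real assume r: "0 < r" "r < 1"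
      \<comment> \<open>One truncation error comes from \<open>S\<close> and \<open>c\<close> times
        the same bound from \<open>T\<close>.\<close>
      define e where "e n = (c + 1) * (2 * r ^ Suc n * (norm x)\<^sup>2 / (1 - r))" for n
      have "e \<longlonglongrightarrow> (c + 1) * (2 * 0 * (norm x)\<^sup>2 / (1 - r))"
        unfolding e_def using r by (intro tendsto_intros LIMSEQ_Suc[OF LIMSEQ_power_zero]) auto
      moreover have "- e n \<le> Re (\<Sum>k\<le>n. poisson_coeff k * a k * z ^ k)" if z: "cmod z = r" for n z
      proof -
        let ?P = "\<lambda>A. \<Sum>k\<le>n. poisson_coeff k * (cinner ((A ^^ k) x) x * z ^ k)"
        let ?b = "2 * r ^ Suc n * (norm x)\<^sup>2 / (1 - r)"
        obtain u where u: "u - z *\<^sub>C S u = x"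
          "cmod (?P S - (2 * cinner u x - of_real ((norm x)\<^sup>2))) \<le> ?b"
          using resolvent[OF S r z, of x] by blast
        obtain y where y: "y - z *\<^sub>C T y = x"
          "cmod (?P T - (2 * cinner y x - of_real ((norm x)\<^sup>2))) \<le> ?b"
          using resolvent[OF T r z, of x] by blast
        have "Re (?P S) \<le> 2 * Re (cinner u x) - (norm x)\<^sup>2 + ?b"
          using order_trans[OF complex_Re_le_cmod u(2)] by (simp del: of_real_power)
        also have "\<dots> \<le> c * (2 * Re (cinner y x) - (norm x)\<^sup>2) + ?b"
          using le[OF _ u(1) y(1)] z r by simp
        also have "\<dots> \<le> c * (Re (?P T) + ?b) + ?b"
        proof -
          have "- Re (?P T - (2 * cinner y x - of_real ((norm x)\<^sup>2))) \<le> ?b"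
            using order_trans[OF abs_Re_le_cmod y(2)] by (simp only: abs_le_iff)
          then have "2 * Re (cinner y x) - (norm x)\<^sup>2 \<le> Re (?P T) + ?b"
            by (simp del: of_real_power)
          then show ?thesis
            using c by (intro add_right_mono mult_left_mono) auto
        qed
        finally have le: "Re (?P S) \<le> c * (Re (?P T) + ?b) + ?b" .
        have "e n = c * ?b + ?b"
          by (simp only: e_def distrib_right mult_1_left)
        then have "- e n \<le> c * Re (?P T) - Re (?P S)"
          using le unfolding distrib_left by linarith
        also have "c * Re (?P T) - Re (?P S) = Re (of_real c * ?P T - ?P S)"
          by simp
        also have "of_real c * ?P T - ?P S = (\<Sum>k\<le>n. poisson_coeff k * a k * z ^ k)"
          unfolding a_def sum_distrib_left sum_subtractf[symmetric]
          by (intro sum.cong refl) (simp add: algebra_simps)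
        finally show ?thesis .
      qed
      ultimately show "\<exists>e. e \<longlonglongrightarrow> 0 \<and>
          (\<forall>n z. cmod z = r \<longrightarrow> - e n \<le> Re (\<Sum>k\<le>n. poisson_coeff k * a k * z ^ k))"
        by (intro exI[of _ e]) auto
    qed
    also have "(\<Sum>i\<le>degree p. coeff p i * a i)
        = of_real c * (\<Sum>i\<le>degree p. coeff p i * cinner ((T ^^ i) x) x)
        - (\<Sum>i\<le>degree p. coeff p i * cinner ((S ^^ i) x) x)"
      by (simp add: a_def right_diff_distrib sum_subtractf sum_distrib_left mult_ac)
    finally show ?thesis
      by simp
  qed
  then show ?thesis
    unfolding harnack_dominated_iff[OF lin] using c by blast
qed

section \<open>Partial isometries and their strict perturbations\<close>

lemma partial_isometry_bounded_clinear: "partial_isometry T \<Longrightarrow> bounded_clinear T"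
  by (simp add: partial_isometry_def)

lemma partial_isometry_idem:
  assumes "partial_isometry T"
  shows "T (cadjoint T (T x)) = T x"
  using assms by (metis partial_isometry_def comp_apply)

lemma partial_isometry_kernel:
  assumes "partial_isometry T"
  shows "T (x - cadjoint T (T x)) = 0"
  by (simp add: bounded_clinear_diff[OF partial_isometry_bounded_clinear]
      partial_isometry_idem assms)

text \<open>Pythagoras: \<open>cadjoint T (T x)\<close> is the projection of \<open>x\<close> to the
  initial space, and \<open>T\<close> is isometric there.\<close>

lemma norm_partial_isometry_square:
  assumes T: "partial_isometry T"
  shows "(norm (T x))\<^sup>2 = (norm x)\<^sup>2 - (norm (x - cadjoint T (T x)))\<^sup>2"
proof -
  note lin = partial_isometry_bounded_clinear[OF T]
  have "Re (cinner x (cadjoint T (T x))) = (norm (T x))\<^sup>2"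
    by (simp only: cinner_cadjoint_right[OF lin] Re_cinner_self)
  moreover have "(norm (cadjoint T (T x)))\<^sup>2 = (norm (T x))\<^sup>2"
    unfolding Re_cinner_self[symmetric] cinner_cadjoint_right[OF lin] partial_isometry_idem[OF T] ..
  ultimately show ?thesis
    by (simp add: norm_diff_square)
qed

lemma partial_isometry_contraction:
  assumes "partial_isometry T"
  shows "contraction T"
proof -
  have "norm (T x) \<le> norm x" for x
  proof (rule power2_le_imp_le)
    show "(norm (T x))\<^sup>2 \<le> (norm x)\<^sup>2"
      using norm_partial_isometry_square[OF assms, of x]
        zero_le_power2[of "norm (x - cadjoint T (T x))"]
      by linarith
  qed simp
  then show ?thesis
    using partial_isometry_bounded_clinear[OF assms] by (simp add: contraction_iff)
qed

lemma norm_kernel_projection_le: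
  assumes "partial_isometry T"
  shows "norm (x - cadjoint T (T x)) \<le> norm x"
proof (rule power2_le_imp_le)
  show "(norm (x - cadjoint T (T x)))\<^sup>2 \<le> (norm x)\<^sup>2"
    using norm_partial_isometry_square[OF assms, of x] zero_le_power2[of "norm (T x)"] by linarith
qed simp

lemma partial_isometry_cadjoint:
  assumes T: "partial_isometry T"
  shows "partial_isometry (cadjoint T)"
proof -
  note lin = partial_isometry_bounded_clinear[OF T]
  have "cadjoint T (T (cadjoint T x)) = cadjoint T x" for x
    by (rule cinner_eqI)
      (simp add: cinner_cadjoint_left[OF lin] cinner_cadjoint_right[OF lin, symmetric]
        partial_isometry_idem[OF T])
  then show ?thesis
    unfolding partial_isometry_def cadjoint_cadjoint[OF lin]
    by (auto simp: bounded_clinear_cadjoint[OF lin])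
qed

text \<open>The complementary projection is positive and idempotent, hence its own positive square
  root.\<close>

lemma defect_op_partial_isometry:
  assumes T: "partial_isometry T"
  shows "defect_op T = (\<lambda>x. x - cadjoint T (T x))"
proof (rule defect_op_eqI[OF partial_isometry_contraction[OF T]])
  note lin = partial_isometry_bounded_clinear[OF T]
  let ?P = "\<lambda>x. x - cadjoint T (T x)"
  have "cinner (?P x) x = of_real ((norm (?P x))\<^sup>2)" for x
    by (simp add: cinner_diff_left cinner_cadjoint_left[OF lin] cinner_self
        norm_partial_isometry_square[OF T] flip: of_real_diff del: of_real_power)
  moreover have "bounded_clinear ?P"
    by (intro bounded_clinear_minus_op bounded_clinear_id
        bounded_clinear_compose[OF bounded_clinear_cadjoint[OF lin] lin])
  ultimately show "positive_op ?P"
    by (simp add: positive_op_def del: of_real_power)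
  show "?P (?P x) = ?P x" for x
    by (simp add: partial_isometry_kernel[OF T]
        bounded_clinear_zero[OF bounded_clinear_cadjoint[OF lin]])
qed

text \<open>\<open>S = T + X\<close>, where \<open>X\<close> maps the kernel of \<open>T\<close> to that of \<open>T\<^sup>*\<close>, vanishes on the orthogonal
  complement of the kernel of \<open>T\<close> and has norm less than 1; \<open>x - T\<^sup>* T x\<close> is the projection of \<open>x\<close>
  to the kernel of \<open>T\<close>.\<close>

definition strict_perturbation :: "('a::complex_hilbert \<Rightarrow> 'a) \<Rightarrow> ('a \<Rightarrow> 'a) \<Rightarrow> bool" where
  "strict_perturbation T S \<longleftrightarrow> bounded_clinear S \<and>
     (\<exists>q. 0 \<le> q \<and> q < 1 \<and> (\<forall>x. norm (S x - T x) \<le> q * norm (x - cadjoint T (T x)))) \<and>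
     (\<forall>x y. cinner (S x - T x) (T y) = 0)"

lemma norm_strict_perturbation_square:
  assumes "strict_perturbation T S"
  shows "(norm (S x))\<^sup>2 = (norm (T x))\<^sup>2 + (norm (S x - T x))\<^sup>2"
  using assms norm_add_square[of "S x - T x" "T x"] by (simp add: strict_perturbation_def)

lemma strict_perturbation_contraction:
  assumes T: "partial_isometry T" and S: "strict_perturbation T S"
  shows "contraction S"
  unfolding contraction_iff
proof (intro conjI allI)
  show "bounded_clinear S"
    using S by (simp add: strict_perturbation_def)
  fix x
  obtain q where q: "0 \<le> q" "q < 1" "norm (S x - T x) \<le> q * norm (x - cadjoint T (T x))"
    using S by (auto simp: strict_perturbation_def)
  then have "norm (S x - T x) \<le> norm (x - cadjoint T (T x))"
    using mult_right_mono[of q 1 "norm (x - cadjoint T (T x))"] by simp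
  then have "(norm (S x - T x))\<^sup>2 \<le> (norm (x - cadjoint T (T x)))\<^sup>2"
    by (simp add: power_mono)
  then have "(norm (S x))\<^sup>2 \<le> (norm x)\<^sup>2"
    using norm_strict_perturbation_square[OF S, of x] norm_partial_isometry_square[OF T, of x]
    by linarith
  then show "norm (S x) \<le> norm x"
    by (rule power2_le_imp_le) simp
qed

text \<open>The kernel projection vanishes at \<open>cadjoint T (T x)\<close>, so the norm bound
  leaves no difference between \<open>S\<close> and \<open>T\<close> there.\<close>

lemma strict_perturbation_initial_space:
  assumes T: "partial_isometry T" and S: "strict_perturbation T S"
  shows "S (cadjoint T (T x)) = T x"
proof -
  note lin = partial_isometry_bounded_clinear[OF T]
  let ?y = "cadjoint T (T x)"
  obtain q where "norm (S ?y - T ?y) \<le> q * norm (?y - cadjoint T (T ?y))"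
    using S by (auto simp: strict_perturbation_def)
  then show ?thesis
    by (simp add: partial_isometry_idem[OF T])
qed

text \<open>Taking adjoints exchanges the two conditions: orthogonality of \<open>X\<close> to the
  range of \<open>T\<close> makes \<open>cadjoint X\<close> depend only on the projection to the
  kernel of \<open>cadjoint T\<close>, and vanishing of \<open>X\<close> on the initial space gives
  the new orthogonality. This transfers facts about the defect of \<open>S\<close> to that of
  \<open>cadjoint S\<close>.\<close>

lemma strict_perturbation_cadjoint:
  assumes T: "partial_isometry T" and S: "strict_perturbation T S"
  shows "strict_perturbation (cadjoint T) (cadjoint S)"
proof -
  note lin = partial_isometry_bounded_clinear[OF T]
  have Slin: "bounded_clinear S" and orth: "\<And>x y. cinner (S x - T x) (T y) = 0"
    using S by (auto simp: strict_perturbation_def)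
  obtain q where q: "0 \<le> q" "q < 1" "\<And>x. norm (S x - T x) \<le> q * norm (x - cadjoint T (T x))"
    using S by (auto simp: strict_perturbation_def)
  define X where "X = (\<lambda>x. S x - T x)"
  have Xlin: "bounded_clinear X"
    unfolding X_def by (intro bounded_clinear_intros lin Slin)
  have Xadj: "cadjoint X = (\<lambda>x. cadjoint S x - cadjoint T x)"
    unfolding X_def by (rule cadjoint_diff[OF Slin lin])
  have Xnorm: "norm (X x) \<le> q * norm x" for x
    using order_trans[OF q(3) mult_left_mono[OF norm_kernel_projection_le[OF T] q(1)]]
    by (simp add: X_def)
  have XT: "cadjoint X (T x) = 0" for x
  proof (rule cinner_eqI)
    show "cinner (cadjoint X (T x)) z = cinner 0 z" for z
      using orth[of z x] cinner_commute[of "T x" "X z"]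
      by (simp add: cinner_cadjoint_left[OF Xlin]) (simp add: X_def)
  qed
  have XTs: "X (cadjoint T y) = 0" for y
    using strict_perturbation_initial_space[OF T S, of "cadjoint T y"]
      partial_isometry_idem[OF partial_isometry_cadjoint[OF T], of y]
    by (simp add: X_def cadjoint_cadjoint[OF lin])
  show ?thesis
    unfolding strict_perturbation_def cadjoint_cadjoint[OF lin]
  proof (intro conjI exI[of _ q] allI q bounded_clinear_cadjoint Slin)
    fix x
    have "cadjoint X x = cadjoint X (x - T (cadjoint T x))"
      by (simp add: bounded_clinear_diff[OF bounded_clinear_cadjoint[OF Xlin]] XT)
    also have "norm \<dots> \<le> q * norm (x - T (cadjoint T x))"
      by (rule norm_cadjoint_le[OF Xlin Xnorm q(1)])
    finally show "norm (cadjoint S x - cadjoint T x) \<le> q * norm (x - T (cadjoint T x))"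
      by (simp add: Xadj)
    fix y
    have "cinner (cadjoint X x) (cadjoint T y) = cinner x (X (cadjoint T y))"
      by (rule cinner_cadjoint_left[OF Xlin])
    then show "cinner (cadjoint S x - cadjoint T x) (cadjoint T y) = 0"
      by (simp add: XTs Xadj)
  qed
qed

text \<open>At \<open>y\<close> in the initial space of \<open>S\<close>, isometry turns the bound
  into an equality that \<open>q < 1\<close> permits only if \<open>S y = T y\<close>. Then
  \<open>S x - T x\<close> lies in the range of \<open>T\<close>, to which it is also
  orthogonal.\<close>

lemma strict_perturbation_partial_isometry_eq:
  assumes T: "partial_isometry T" and S: "strict_perturbation T S" "partial_isometry S"
  shows "S = T"
proof
  fix x
  note Tlin = partial_isometry_bounded_clinear[OF T]
    and Slin = partial_isometry_bounded_clinear[OF S(2)]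
  define y where "y = cadjoint S (S x)"
  have Sy: "S y = S x"
    by (simp add: y_def partial_isometry_idem[OF S(2)])
  have "(norm (S y))\<^sup>2 = (norm y)\<^sup>2"
    using norm_partial_isometry_square[OF S(2), of y] by (simp add: Sy) (simp add: y_def)
  then have eq: "(norm (S y - T y))\<^sup>2 = (norm (y - cadjoint T (T y)))\<^sup>2"
    using norm_strict_perturbation_square[OF S(1), of y] norm_partial_isometry_square[OF T, of y]
    by simp
  obtain q where q: "0 \<le> q" "q < 1" "norm (S y - T y) \<le> q * norm (y - cadjoint T (T y))"
    using S(1) by (auto simp: strict_perturbation_def)
  have "norm (S y - T y) = norm (y - cadjoint T (T y))"
    using eq by (rule power2_eq_imp_eq) simp_all
  with q have "norm (S y - T y) \<le> q * norm (S y - T y)"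
    by simp
  then have "(1 - q) * norm (S y - T y) \<le> 0"
    by (simp add: algebra_simps)
  then have "S y = T y"
    using q by (simp add: mult_le_0_iff)
  then have "S x - T x = T (y - x)"
    by (simp add: Sy bounded_clinear_diff[OF Tlin])
  then have "cinner (S x - T x) (S x - T x) = 0"
    using S(1) by (metis strict_perturbation_def)
  then show "S x = T x"
    by (simp add: cinner_self del: of_real_power)
qed

section \<open>The Harnack part of a partial isometry\<close>

text \<open>Since \<open>u - x = z *\<^sub>C A u\<close>, expanding the square of its norm gives the
  identity.\<close>

lemma resolvent_form_eq:
  assumes "u - z *\<^sub>C A u = x"
  shows "2 * Re (cinner u x) - (norm x)\<^sup>2 = (norm u)\<^sup>2 - (cmod z)\<^sup>2 * (norm (A u))\<^sup>2"
proof -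
  have "(cmod z)\<^sup>2 * (norm (A u))\<^sup>2 = (norm (u - x))\<^sup>2"
  proof -
    have "u - x = z *\<^sub>C A u"
      unfolding assms[symmetric] by simp
    then show ?thesis
      by (simp add: norm_scaleC power_mult_distrib)
  qed
  then show ?thesis
    by (simp add: norm_diff_square)
qed

text \<open>If \<open>u\<close> and \<open>y\<close> are the resolvents of \<open>S\<close> and \<open>T\<close> at \<open>x\<close>, then
  \<open>u - y = z T (u - y) + z X u\<close> with orthogonal summands. In the seminorm
  \<open>\<nu> w = sqrt (\<parallel>w\<parallel>\<^sup>2 - \<bar>z\<bar>\<^sup>2 \<parallel>T w\<parallel>\<^sup>2)\<close> this says \<open>\<nu> (u - y) = \<bar>z\<bar> \<parallel>X u\<parallel> \<le> q \<nu> u\<close>,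
  and the Poisson kernels of \<open>T\<close> and \<open>S\<close> at \<open>x\<close> are \<open>(\<nu> y)\<^sup>2\<close> and \<open>(\<nu> u)\<^sup>2 - \<bar>z\<bar>\<^sup>2 \<parallel>X u\<parallel>\<^sup>2\<close>.\<close>

lemma strict_perturbation_resolvent_comparison:
  assumes T: "partial_isometry T" and S: "strict_perturbation T S"
  obtains c where "1 \<le> c"
    "\<And>z x u y. cmod z < 1 \<Longrightarrow> u - z *\<^sub>C S u = x \<Longrightarrow> y - z *\<^sub>C T y = x \<Longrightarrow>
      2 * Re (cinner u x) - (norm x)\<^sup>2 \<le> c * (2 * Re (cinner y x) - (norm x)\<^sup>2) \<and>
      2 * Re (cinner y x) - (norm x)\<^sup>2 \<le> c * (2 * Re (cinner u x) - (norm x)\<^sup>2)"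
proof -
  note lin = partial_isometry_bounded_clinear[OF T]
  have orth: "\<And>x y. cinner (S x - T x) (T y) = 0"
    using S by (auto simp: strict_perturbation_def)
  obtain q where q: "0 \<le> q" "q < 1" "\<And>x. norm (S x - T x) \<le> q * norm (x - cadjoint T (T x))"
    using S by (auto simp: strict_perturbation_def)
  have q2: "q\<^sup>2 < 1"
    using q by (simp add: abs_square_less_1)
  \<comment> \<open>The first term comes from \<open>(1 - q) * \<nu> u \<le> \<nu> y\<close>. The
    second combines \<open>\<nu> y \<le> (1 + q) * \<nu> u\<close> with the factor
    \<open>1 - q\<^sup>2\<close> lost by subtracting the \<open>X u\<close> term.\<close>
  define c where "c = max (1 / (1 - q)\<^sup>2) ((1 + q)\<^sup>2 / (1 - q\<^sup>2))"
  have c1: "1 \<le> c"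
    unfolding c_def using q by (intro max.coboundedI1) (simp add: power_le_one)
  show ?thesis
  proof (rule that[OF c1])
    fix z x u y
    assume z: "cmod z < 1" and u: "u - z *\<^sub>C S u = x" and y: "y - z *\<^sub>C T y = x"
    let ?P = "\<lambda>w. w - cadjoint T (T w)"
    \<comment> \<open>Written as a norm in the product space, \<open>\<nu>\<close> inherits the
      triangle inequality; \<open>\<nu>sq\<close> identifies it with the intended seminorm.\<close>
    define \<nu> where "\<nu> w = norm (sqrt (1 - (cmod z)\<^sup>2) *\<^sub>R w, cmod z *\<^sub>R ?P w)" for w
    have z2: "(cmod z)\<^sup>2 \<le> 1"
      using z by (simp add: power_le_one)
    have \<nu>_expand: "(\<nu> w)\<^sup>2 = (1 - (cmod z)\<^sup>2) * (norm w)\<^sup>2 + (cmod z)\<^sup>2 * (norm (?P w))\<^sup>2" for w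
    proof -
      have "(\<nu> w)\<^sup>2 = (norm (sqrt (1 - (cmod z)\<^sup>2) *\<^sub>R w))\<^sup>2 + (norm (cmod z *\<^sub>R ?P w))\<^sup>2"
        unfolding \<nu>_def norm_Pair by (rule real_sqrt_pow2) simp
      then show ?thesis
        unfolding norm_scaleR power_mult_distrib using z2 by simp
    qed
    have \<nu>sq: "(\<nu> w)\<^sup>2 = (norm w)\<^sup>2 - (cmod z)\<^sup>2 * (norm (T w))\<^sup>2" for w
      by (simp add: \<nu>_expand norm_partial_isometry_square[OF T] algebra_simps)
    have \<nu>0: "0 \<le> \<nu> w" for w
      by (simp add: \<nu>_def)
    have \<nu>_diff: "\<nu> (v - w) \<le> \<nu> v + \<nu> w" for v w
    proof -
      have "(sqrt (1 - (cmod z)\<^sup>2) *\<^sub>R (v - w), cmod z *\<^sub>R ?P (v - w))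
          = (sqrt (1 - (cmod z)\<^sup>2) *\<^sub>R v, cmod z *\<^sub>R ?P v)
            - (sqrt (1 - (cmod z)\<^sup>2) *\<^sub>R w, cmod z *\<^sub>R ?P w)"
        by (simp add: bounded_clinear_diff[OF lin]
            bounded_clinear_diff[OF bounded_clinear_cadjoint[OF lin]] algebra_simps)
      then show ?thesis
        unfolding \<nu>_def by (metis norm_triangle_ineq4)
    qed
    have \<nu>_sym: "\<nu> (v - w) = \<nu> (w - v)" for v w
    proof -
      have "(\<nu> (v - w))\<^sup>2 = (\<nu> (w - v))\<^sup>2"
        by (simp add: \<nu>sq norm_minus_commute bounded_clinear_diff[OF lin])
      then show ?thesis
        by (simp add: power2_eq_iff_nonneg \<nu>0)
    qed
    have X\<nu>: "(cmod z)\<^sup>2 * (norm (S w - T w))\<^sup>2 \<le> (q * \<nu> w)\<^sup>2" for w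
    proof -
      have "(norm (S w - T w))\<^sup>2 \<le> (q * norm (?P w))\<^sup>2"
        by (intro power_mono q) auto
      then have "(cmod z)\<^sup>2 * (norm (S w - T w))\<^sup>2 \<le> (cmod z)\<^sup>2 * (q * norm (?P w))\<^sup>2"
        by (intro mult_left_mono) auto
      also have "\<dots> = q\<^sup>2 * ((cmod z)\<^sup>2 * (norm (?P w))\<^sup>2)"
        by (simp add: power_mult_distrib)
      also have "\<dots> \<le> q\<^sup>2 * (\<nu> w)\<^sup>2"
        using z2 by (intro mult_left_mono) (auto simp: \<nu>_expand)
      finally show ?thesis
        by (simp add: power_mult_distrib)
    qed
    define d where "d = u - y"
    have d: "d = z *\<^sub>C T d + z *\<^sub>C (S u - T u)"
    proof -
      have "d = (u - z *\<^sub>C S u) - (y - z *\<^sub>C T y) + (z *\<^sub>C S u - z *\<^sub>C T y)"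
        by (simp add: d_def)
      then have "d = z *\<^sub>C S u - z *\<^sub>C T y"
        unfolding u y by simp
      moreover have "z *\<^sub>C T d + z *\<^sub>C (S u - T u) = z *\<^sub>C S u - z *\<^sub>C T y"
        by (simp add: d_def bounded_clinear_diff[OF lin] scaleC_diff_right)
      ultimately show ?thesis
        by (simp only:)
    qed
    have "(norm d)\<^sup>2 = (cmod z)\<^sup>2 * (norm (T d))\<^sup>2 + (cmod z)\<^sup>2 * (norm (S u - T u))\<^sup>2"
    proof -
      have "cinner (z *\<^sub>C T d) (z *\<^sub>C (S u - T u)) = 0"
        using orth[of u d] cinner_commute[of "T d" "S u - T u"]
        by (simp add: cinner_scaleC_left cinner_scaleC_right)
      then show ?thesis
        using norm_add_square[of "z *\<^sub>C T d" "z *\<^sub>C (S u - T u)"]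
        unfolding d[symmetric] norm_scaleC power_mult_distrib by simp
    qed
    then have "(\<nu> d)\<^sup>2 \<le> (q * \<nu> u)\<^sup>2"
      using X\<nu>[of u] \<nu>sq[of d] by linarith
    then have \<nu>d: "\<nu> d \<le> q * \<nu> u"
      by (rule power2_le_imp_le) (rule mult_nonneg_nonneg[OF q(1) \<nu>0])
    have "\<nu> y \<le> \<nu> u + \<nu> d"
      using \<nu>_diff[of u d] by (simp add: d_def)
    with \<nu>d have y_le: "\<nu> y \<le> (1 + q) * \<nu> u"
      by (simp add: algebra_simps)
    have "\<nu> u \<le> \<nu> y + \<nu> d"
      using \<nu>_diff[of y "y - u"] by (simp add: d_def \<nu>_sym[of y u])
    with \<nu>d have u_le: "(1 - q) * \<nu> u \<le> \<nu> y"
      by (simp add: algebra_simps)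
    have KT: "2 * Re (cinner y x) - (norm x)\<^sup>2 = (\<nu> y)\<^sup>2"
      by (simp add: resolvent_form_eq[where A = T, OF y] \<nu>sq)
    have KS: "2 * Re (cinner u x) - (norm x)\<^sup>2 = (\<nu> u)\<^sup>2 - (cmod z)\<^sup>2 * (norm (S u - T u))\<^sup>2"
      by (simp add: resolvent_form_eq[where A = S, OF u] \<nu>sq
          norm_strict_perturbation_square[OF S] algebra_simps)
    have "((1 - q) * \<nu> u)\<^sup>2 \<le> (\<nu> y)\<^sup>2"
      using u_le q \<nu>0 by (intro power_mono) auto
    then have "(\<nu> u)\<^sup>2 \<le> 1 / (1 - q)\<^sup>2 * (\<nu> y)\<^sup>2"
      unfolding power_mult_distrib using q by (simp add: pos_le_divide_eq mult.commute)
    also have "\<dots> \<le> c * (\<nu> y)\<^sup>2"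
      by (intro mult_right_mono) (auto simp: c_def)
    finally have 1: "2 * Re (cinner u x) - (norm x)\<^sup>2 \<le> c * (2 * Re (cinner y x) - (norm x)\<^sup>2)"
      unfolding KT KS by (smt (verit) mult_nonneg_nonneg zero_le_power2)
    have lower: "(1 - q\<^sup>2) * (\<nu> u)\<^sup>2 \<le> 2 * Re (cinner u x) - (norm x)\<^sup>2"
      unfolding KS using X\<nu>[of u] by (simp add: power_mult_distrib algebra_simps)
    have "(\<nu> y)\<^sup>2 \<le> ((1 + q) * \<nu> u)\<^sup>2"
      using y_le \<nu>0 by (intro power_mono) auto
    also have "\<dots> = (1 + q)\<^sup>2 / (1 - q\<^sup>2) * ((1 - q\<^sup>2) * (\<nu> u)\<^sup>2)"
      using q2 by (simp add: power_mult_distrib)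
    also have "\<dots> \<le> (1 + q)\<^sup>2 / (1 - q\<^sup>2) * (2 * Re (cinner u x) - (norm x)\<^sup>2)"
      using q2 by (intro mult_left_mono lower) auto
    also have "\<dots> \<le> c * (2 * Re (cinner u x) - (norm x)\<^sup>2)"
    proof (intro mult_right_mono)
      show "0 \<le> 2 * Re (cinner u x) - (norm x)\<^sup>2"
        using lower q2 by (smt (verit) mult_nonneg_nonneg zero_le_power2)
    qed (simp add: c_def)
    finally show "2 * Re (cinner u x) - (norm x)\<^sup>2 \<le> c * (2 * Re (cinner y x) - (norm x)\<^sup>2) \<and>
        2 * Re (cinner y x) - (norm x)\<^sup>2 \<le> c * (2 * Re (cinner u x) - (norm x)\<^sup>2)"
      using 1 by (simp add: KT)
  qed
qed

lemma strict_perturbation_imp_harnack_equivalent: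
  assumes T: "partial_isometry T" and S: "strict_perturbation T S"
  shows "harnack_equivalent S T"
proof -
  obtain c where c: "1 \<le> c"
    and le: "\<And>z x u y. cmod z < 1 \<Longrightarrow> u - z *\<^sub>C S u = x \<Longrightarrow> y - z *\<^sub>C T y = x \<Longrightarrow>
      2 * Re (cinner u x) - (norm x)\<^sup>2 \<le> c * (2 * Re (cinner y x) - (norm x)\<^sup>2) \<and>
      2 * Re (cinner y x) - (norm x)\<^sup>2 \<le> c * (2 * Re (cinner u x) - (norm x)\<^sup>2)"
    using strict_perturbation_resolvent_comparison[OF T S] by metis
  note contr = strict_perturbation_contraction[OF T S] partial_isometry_contraction[OF T]
  show ?thesis
    unfolding harnack_equivalent_def
    using harnack_dominated_if_resolvent_le[OF contr c]
      harnack_dominated_if_resolvent_le[OF contr(2) contr(1) c] le by blast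
qed

text \<open>Solving the inequality for \<open>a\<close> produces a factor below 1. This is the
  origin of \<open>q\<close> for both the Harnack and the Shmul'yan part.\<close>

lemma strict_ratio:
  fixes a b C :: real
  assumes "a\<^sup>2 \<le> C * (b\<^sup>2 - a\<^sup>2)" "0 \<le> C" "0 \<le> b"
  shows "a \<le> sqrt (C / (1 + C)) * b"
proof (rule power2_le_imp_le)
  have "(1 + C) * a\<^sup>2 \<le> C * b\<^sup>2"
    using assms by (simp add: algebra_simps)
  then have "a\<^sup>2 \<le> C / (1 + C) * b\<^sup>2"
    using assms by (simp add: field_simps)
  then show "a\<^sup>2 \<le> (sqrt (C / (1 + C)) * b)\<^sup>2"
    using assms by (simp add: power_mult_distrib)
qed (use assms in simp)

lemma harnack_equivalent_imp_strict_perturbation: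
  assumes T: "partial_isometry T" and S: "contraction S" and equiv: "harnack_equivalent S T"
  shows "strict_perturbation T S"
proof -
  note Tlin = partial_isometry_bounded_clinear[OF T]
  have Slin: "bounded_clinear S" and Snorm: "\<And>x. norm (S x) \<le> norm x"
    using S by (auto simp: contraction_iff)
  obtain c where c: "1 \<le> c" "\<And>g h. (norm g)\<^sup>2 + (norm h)\<^sup>2 + 2 * Re (cinner (S g) h)
      \<le> c * ((norm g)\<^sup>2 + (norm h)\<^sup>2 + 2 * Re (cinner (T g) h))"
    using harnack_dominated_quadratic[OF Slin Tlin] equiv unfolding harnack_equivalent_def by metis
  obtain c' where c': "1 \<le> c'" "\<And>g h. (norm g)\<^sup>2 + (norm h)\<^sup>2 + 2 * Re (cinner (T g) h)
      \<le> c' * ((norm g)\<^sup>2 + (norm h)\<^sup>2 + 2 * Re (cinner (S g) h))"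
    using harnack_dominated_quadratic[OF Tlin Slin] equiv unfolding harnack_equivalent_def by metis
  \<comment> \<open>With \<open>h = - T g\<close> the right-hand form is the squared defect of
    \<open>T\<close>, which vanishes on the initial space and forces \<open>S = T\<close>
    there.\<close>
  have ST: "(norm (S g - T g))\<^sup>2 \<le> c * (norm (g - cadjoint T (T g)))\<^sup>2" for g
  proof -
    have "(norm (S g - T g))\<^sup>2 \<le> (norm (S g - T g))\<^sup>2 + ((norm g)\<^sup>2 - (norm (S g))\<^sup>2)"
      using Snorm[of g] by (simp add: power_mono)
    also have "\<dots> = (norm g)\<^sup>2 + (norm (- T g))\<^sup>2 + 2 * Re (cinner (S g) (- T g))"
      by (simp add: norm_diff_square cinner_minus_right)
    also have "\<dots> \<le> c * ((norm g)\<^sup>2 + (norm (- T g))\<^sup>2 + 2 * Re (cinner (T g) (- T g)))"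
      by (rule c)
    also have "\<dots> = c * (norm (g - cadjoint T (T g)))\<^sup>2"
      using norm_partial_isometry_square[OF T, of g]
      by (simp add: cinner_minus_right Re_cinner_self)
    finally show ?thesis .
  qed
  \<comment> \<open>With \<open>h = - S g\<close> the right-hand form is the squared defect of
    \<open>S\<close>; on the kernel of \<open>T\<close> this is the input for
    \<open>strict_ratio\<close>.\<close>
  have TS: "(norm (S g - T g))\<^sup>2 \<le> c' * ((norm g)\<^sup>2 - (norm (S g))\<^sup>2)" for g
  proof -
    have "(norm (S g - T g))\<^sup>2 \<le> (norm (S g - T g))\<^sup>2 + ((norm g)\<^sup>2 - (norm (T g))\<^sup>2)"
      using partial_isometry_contraction[OF T] by (simp add: contraction_iff power_mono)
    also have "\<dots> = (norm g)\<^sup>2 + (norm (- S g))\<^sup>2 + 2 * Re (cinner (T g) (- S g))"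
      using Re_cinner_commute[of "S g" "T g"] by (simp add: norm_diff_square cinner_minus_right)
    also have "\<dots> \<le> c' * ((norm g)\<^sup>2 + (norm (- S g))\<^sup>2 + 2 * Re (cinner (S g) (- S g)))"
      by (rule c')
    also have "\<dots> = c' * ((norm g)\<^sup>2 - (norm (S g))\<^sup>2)"
      by (simp add: cinner_minus_right Re_cinner_self)
    finally show ?thesis .
  qed
  show ?thesis
    unfolding strict_perturbation_def
  proof (intro conjI allI Slin exI[of _ "sqrt (c' / (1 + c'))"])
    show "0 \<le> sqrt (c' / (1 + c'))" "sqrt (c' / (1 + c')) < 1"
      using c' by auto
    fix x
    let ?v = "x - cadjoint T (T x)"
    have "S (cadjoint T (T x)) = T (cadjoint T (T x))"
      using ST[of "cadjoint T (T x)"] by (simp add: partial_isometry_idem[OF T])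
    then have eq: "S ?v = S x - T x" and Tv: "T ?v = 0"
      by (simp_all add: bounded_clinear_diff[OF Slin] bounded_clinear_diff[OF Tlin]
          partial_isometry_idem[OF T])
    then show "norm (S x - T x) \<le> sqrt (c' / (1 + c')) * norm ?v"
      using TS[of ?v] c' by (intro strict_ratio) auto
    fix y
    let ?g = "cadjoint T (T y)"
    \<comment> \<open>At \<open>- ?g\<close> and \<open>T y\<close> the form of \<open>T\<close>
      vanishes, so \<open>cadjoint S\<close> and \<open>cadjoint T\<close> agree on the range of
      \<open>T\<close>; this is the orthogonality of the difference to that range.\<close>
    have "(norm (cadjoint S (T y) - ?g))\<^sup>2
        \<le> (norm (cadjoint S (T y) - ?g))\<^sup>2 + ((norm (T y))\<^sup>2 - (norm (cadjoint S (T y)))\<^sup>2)"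
      using norm_cadjoint_contraction[OF S] by (simp add: power_mono)
    also have "\<dots> = (norm (- ?g))\<^sup>2 + (norm (T y))\<^sup>2 + 2 * Re (cinner (S (- ?g)) (T y))"
      using Re_cinner_commute[of "cadjoint S (T y)" ?g]
      by (simp add: norm_diff_square bounded_clinear_minus[OF Slin] cinner_minus_left
          cinner_cadjoint_right[OF Slin])
    also have "\<dots> \<le> c * ((norm (- ?g))\<^sup>2 + (norm (T y))\<^sup>2 + 2 * Re (cinner (T (- ?g)) (T y)))"
      by (rule c)
    also have "\<dots> = 0"
    proof -
      have "(norm ?g)\<^sup>2 = (norm (T y))\<^sup>2"
        using norm_partial_isometry_square[OF T, of ?g] by (simp add: partial_isometry_idem[OF T])
      then show ?thesis
        by (simp add: bounded_clinear_minus[OF Tlin] cinner_minus_left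
            partial_isometry_idem[OF T] Re_cinner_self)
    qed
    finally have "cadjoint S (T y) = ?g"
      by simp
    then show "cinner (S x - T x) (T y) = 0"
      by (metis cinner_cadjoint_right[OF Slin] cinner_cadjoint_right[OF Tlin]
          cinner_diff_left diff_self)
  qed
qed

section \<open>The Shmul'yan part of a partial isometry\<close>

text \<open>Domination by \<open>T\<close> sandwiches the difference between the two kernel
  projections, which gives its shape. Domination by \<open>S\<close> bounds it by the defect of
  \<open>S\<close>, which gives strictness through \<open>strict_ratio\<close>.\<close>

lemma shmulyan_equivalent_imp_strict_perturbation:
  assumes T: "partial_isometry T" and S: "contraction S" and equiv: "shmulyan_equivalent S T"
  shows "strict_perturbation T S"
proof -
  note Tlin = partial_isometry_bounded_clinear[OF T]
  have Slin: "bounded_clinear S"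
    using S by (auto simp: contraction_iff)
  let ?P = "\<lambda>x. x - cadjoint T (T x)" and ?Q = "\<lambda>x. x - T (cadjoint T x)"
  have PP: "?P (?P x) = ?P x" for x
    by (simp add: partial_isometry_kernel[OF T]
        bounded_clinear_zero[OF bounded_clinear_cadjoint[OF Tlin]])
  obtain X where "S = (\<lambda>x. T x + defect_op (cadjoint T) (X (defect_op T x)))"
    using equiv unfolding shmulyan_equivalent_def shmulyan_dominates_def by blast
  then have X: "S x - T x = ?Q (X (?P x))" for x
    by (simp add: defect_op_partial_isometry T partial_isometry_cadjoint cadjoint_cadjoint[OF Tlin])
  obtain Y where Y: "bounded_clinear_between (defect_space S) (defect_space (cadjoint S)) Y"
    "T = (\<lambda>x. S x + defect_op (cadjoint S) (Y (defect_op S x)))"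
    using equiv unfolding shmulyan_equivalent_def shmulyan_dominates_def by blast
  obtain K where K: "\<And>v. v \<in> defect_space S \<Longrightarrow> norm (Y v) \<le> K * norm v"
    using Y(1) unfolding bounded_clinear_between_def by blast
  have bound: "(norm (S x - T x))\<^sup>2 \<le> K\<^sup>2 * ((norm x)\<^sup>2 - (norm (S x))\<^sup>2)" for x
  proof -
    have "T x - S x = defect_op (cadjoint S) (Y (defect_op S x))"
      by (subst Y(2)) simp
    then have "norm (S x - T x) = norm (defect_op (cadjoint S) (Y (defect_op S x)))"
      by (metis norm_minus_commute)
    also have "\<dots> \<le> norm (Y (defect_op S x))"
    proof (rule power2_le_imp_le)
      show "(norm (defect_op (cadjoint S) v))\<^sup>2 \<le> (norm v)\<^sup>2" for v
        using norm_defect_op_square[OF contraction_cadjoint[OF S], of v]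
          zero_le_power2[of "norm (cadjoint S v)"] by linarith
    qed simp
    also have "\<dots> \<le> K * norm (defect_op S x)"
      by (intro K) (simp add: defect_space_def closure_def)
    finally have "(norm (S x - T x))\<^sup>2 \<le> (K * norm (defect_op S x))\<^sup>2"
      by (intro power_mono) auto
    then show ?thesis
      by (simp add: power_mult_distrib norm_defect_op_square[OF S])
  qed
  show ?thesis
    unfolding strict_perturbation_def
  proof (intro conjI allI Slin exI[of _ "sqrt (K\<^sup>2 / (1 + K\<^sup>2))"])
    show "0 \<le> sqrt (K\<^sup>2 / (1 + K\<^sup>2))"
      by simp
    show "sqrt (K\<^sup>2 / (1 + K\<^sup>2)) < 1"
      by (simp add: add_pos_nonneg)
    fix x
    have "S (?P x) - T (?P x) = S x - T x"
      by (simp only: X PP)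
    then have "S (?P x) = S x - T x"
      by (simp add: partial_isometry_kernel[OF T])
    then show "norm (S x - T x) \<le> sqrt (K\<^sup>2 / (1 + K\<^sup>2)) * norm (?P x)"
      using bound[of "?P x"] by (intro strict_ratio) (auto simp: partial_isometry_kernel[OF T])
    show "cinner (S x - T x) (T y) = 0" for y
      unfolding X
      by (simp add: cinner_diff_left cinner_cadjoint_right[OF Tlin, symmetric])
        (simp add: cinner_cadjoint_left[OF Tlin] partial_isometry_idem[OF T])
  qed
qed

lemma bounded_clinear_betweenI:
  assumes X: "bounded_clinear X" and "\<And>x. X x \<in> V"
  shows "bounded_clinear_between U V X"
proof -
  obtain K where "\<And>x. norm (X x) \<le> K * norm x"
    using bounded_linear.bounded[OF bounded_clinear_bounded_linear[OF X]]
    by (auto simp: mult.commute)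
  then show ?thesis
    unfolding bounded_clinear_between_def
    using assms by (auto simp: bounded_clinear_add[OF X] bounded_clinear_scaleC[OF X])
qed

text \<open>The ranges of \<open>T\<close> and \<open>X = S - T\<close> are orthogonal, so the cross
  terms in \<open>cadjoint S (S x)\<close> drop out.\<close>

lemma strict_perturbation_defect:
  assumes T: "partial_isometry T" and S: "strict_perturbation T S"
  shows "defect_op S (defect_op S x)
    = x - cadjoint T (T x) - cadjoint (\<lambda>x. S x - T x) (S x - T x)"
proof -
  note Tlin = partial_isometry_bounded_clinear[OF T]
  have Slin: "bounded_clinear S" and orth: "\<And>x y. cinner (S x - T x) (T y) = 0"
    using S by (auto simp: strict_perturbation_def)
  have Xlin: "bounded_clinear (\<lambda>x. S x - T x)"
    by (intro bounded_clinear_intros Tlin Slin)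
  have "cadjoint S (S x) = cadjoint T (T x) + cadjoint (\<lambda>x. S x - T x) (S x - T x)"
  proof (rule cinner_eqI)
    fix z
    have "cinner (S x - T x) (T z) = 0" "cinner (T x) (S z - T z) = 0"
      using orth cinner_commute[of "T x" "S z - T z"] by auto
    then show "cinner (cadjoint S (S x)) z
        = cinner (cadjoint T (T x) + cadjoint (\<lambda>x. S x - T x) (S x - T x)) z"
      by (simp add: cinner_add_left cinner_cadjoint_left[OF Slin] cinner_cadjoint_left[OF Tlin]
          cinner_cadjoint_left[OF Xlin] cinner_diff_left cinner_diff_right)
  qed
  then show ?thesis
    by (simp add: defect_op_defect_op[OF strict_perturbation_contraction[OF T S]])
qed

lemma strict_perturbation_imp_shmulyan_equivalent:
  assumes T: "partial_isometry T" and S: "strict_perturbation T S"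
  shows "shmulyan_equivalent S T"
proof -
  note Tlin = partial_isometry_bounded_clinear[OF T]
  note contr = strict_perturbation_contraction[OF T S]
  have Slin: "bounded_clinear S" and orth: "\<And>x y. cinner (S x - T x) (T y) = 0"
    using S by (auto simp: strict_perturbation_def)
  define X where "X = (\<lambda>x. S x - T x)"
  have Xlin: "bounded_clinear X"
    unfolding X_def by (intro bounded_clinear_intros Tlin Slin)
  have Xadj: "cadjoint X = (\<lambda>x. cadjoint S x - cadjoint T x)"
    unfolding X_def by (rule cadjoint_diff[OF Slin Tlin])
  obtain q where q: "0 \<le> q" "q < 1" "\<And>x. norm (X x) \<le> q * norm (x - cadjoint T (T x))"
    using S by (auto simp: strict_perturbation_def X_def)
  have TX: "cadjoint T (X x) = 0" for x
    by (rule cinner_eqI) (simp add: cinner_cadjoint_left[OF Tlin] X_def orth)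
  have XP: "X (x - cadjoint T (T x)) = X x" for x
    by (simp add: X_def bounded_clinear_diff[OF Slin] partial_isometry_kernel[OF T]
        strict_perturbation_initial_space[OF T S])
  have Xnorm: "norm (X x) \<le> q * norm x" for x
    by (rule order_trans[OF q(3) mult_left_mono[OF norm_kernel_projection_le[OF T] q(1)]])
  have Xadjnorm: "norm (cadjoint X x) \<le> q * norm x" for x
    by (rule norm_cadjoint_le[OF Xlin Xnorm q(1)])
  note Xadjlin = bounded_clinear_cadjoint[OF Xlin]
  have q2: "0 \<le> q * q" "q * q < 1"
    using q mult_strict_mono'[of q 1 q 1] by auto
  have "norm (cadjoint X (X x)) \<le> q * q * norm x" for x
    using order_trans[OF Xadjnorm mult_left_mono[OF Xnorm q(1)]] by (simp add: mult.assoc)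
  \<comment> \<open>\<open>E\<close> and \<open>F\<close> invert \<open>I - X\<^sup>* X\<close> and
    \<open>I - X X\<^sup>*\<close>; this is where the norm of \<open>X\<close> must be below
    1.\<close>
  then obtain E where E: "bounded_clinear E" "\<And>x. E (x - cadjoint X (X x)) = x"
    using neumann_inverse[OF bounded_clinear_compose[OF Xadjlin Xlin] _ q2] by metis
  have "norm (X (cadjoint X x)) \<le> q * q * norm x" for x
    using order_trans[OF Xnorm mult_left_mono[OF Xadjnorm q(1)]] by (simp add: mult.assoc)
  then obtain F where F: "bounded_clinear F" "\<And>x. F x - X (cadjoint X (F x)) = x"
    using neumann_inverse[OF bounded_clinear_compose[OF Xlin Xadjlin] _ q2] by metis
  let ?D = "defect_op S" and ?D' = "defect_op (cadjoint S)"
  have Dlin: "bounded_clinear ?D" "bounded_clinear ?D'"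
    using positive_defect_op contr contraction_cadjoint positive_op_bounded_clinear by blast+
  have DD: "?D (?D x) = x - cadjoint T (T x) - cadjoint X (X x)" for x
    unfolding strict_perturbation_defect[OF T S] X_def ..
  have DD': "?D' (?D' x) = x - T (cadjoint T x) - X (cadjoint X x)" for x
  proof -
    have "cadjoint (\<lambda>x. cadjoint S x - cadjoint T x) = X"
      using cadjoint_cadjoint[OF Xlin] by (simp add: Xadj)
    then show ?thesis
      using strict_perturbation_defect[OF partial_isometry_cadjoint[OF T]
          strict_perturbation_cadjoint[OF T S]]
      by (simp add: cadjoint_cadjoint[OF Tlin] Xadj)
  qed
  have "shmulyan_dominates T S"
    unfolding shmulyan_dominates_def
  proof (intro exI[of _ X] conjI bounded_clinear_betweenI Xlin)
    have fix_X: "defect_op (cadjoint T) (X x) = X x" for x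
      by (simp add: defect_op_partial_isometry[OF partial_isometry_cadjoint[OF T]]
          cadjoint_cadjoint[OF Tlin] TX bounded_clinear_zero[OF Tlin])
    show "X x \<in> defect_space (cadjoint T)" for x
      unfolding defect_space_def by (rule closure_subset[THEN subsetD]) (metis fix_X rangeI)
    show "S = (\<lambda>x. T x + defect_op (cadjoint T) (X (defect_op T x)))"
      by (simp add: fix_X defect_op_partial_isometry[OF T] XP) (simp add: X_def)
  qed
  moreover have "shmulyan_dominates S T"
  proof -
    \<comment> \<open>\<open>Y\<close> must satisfy \<open>?D' Y ?D = - X\<close>. One more factor
      \<open>?D'\<close> and \<open>?D\<close> turns the outer operators into squared defects, which
      act as the operators inverted by \<open>F\<close> and \<open>E\<close>; the inner minus sign
      supplies the sign.\<close>
    define Y where "Y v = ?D' (F (X (E (?D (- v)))))" for v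
    have Ylin: "bounded_clinear Y"
      unfolding Y_def
      by (intro bounded_clinear_compose[OF Dlin(2)] bounded_clinear_compose[OF F(1)]
          bounded_clinear_compose[OF Xlin] bounded_clinear_compose[OF E(1)]
          bounded_clinear_compose[OF Dlin(1)])
        (rule bounded_clinear_minus_op[OF bounded_clinear_const_zero bounded_clinear_id, simplified])
    have "T x = S x + ?D' (Y (?D x))" for x
    proof -
      let ?v = "x - cadjoint T (T x)"
      have "E (?D (?D x)) = E (?v - cadjoint X (X ?v))"
        by (simp only: DD XP)
      then have "E (?D (- ?D x)) = - ?v"
        by (simp only: E(2) bounded_clinear_minus[OF Dlin(1)] bounded_clinear_minus[OF E(1)])
      then have "X (E (?D (- ?D x))) = - X x"
        by (simp only: bounded_clinear_minus[OF Xlin] XP)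
      then have "?D' (Y (?D x)) = ?D' (?D' (F (- X x)))"
        by (simp only: Y_def)
      also have "\<dots> = - X x"
      proof -
        let ?f = "F (- X x)"
        \<comment> \<open>The value of \<open>F\<close> lies in the range of \<open>X\<close>, so
          \<open>cadjoint T\<close> kills it and the squared defect of \<open>cadjoint S\<close>
          acts there exactly as the operator that \<open>F\<close> inverts.\<close>
        have "?f = X (cadjoint X ?f - x)"
          using F(2)[of "- X x"] by (simp add: bounded_clinear_diff[OF Xlin] algebra_simps)
        then have "cadjoint T ?f = 0"
          by (metis TX)
        then show ?thesis
          using F(2)[of "- X x"] by (simp add: DD' bounded_clinear_zero[OF Tlin])
      qed
      finally show ?thesis
        by (simp add: X_def)
    qed
    moreover have "bounded_clinear_between (defect_space S) (defect_space (cadjoint S)) Y"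
    proof (rule bounded_clinear_betweenI[OF Ylin])
      show "Y x \<in> defect_space (cadjoint S)" for x
        unfolding defect_space_def Y_def by (rule closure_subset[THEN subsetD]) (rule rangeI)
    qed
    ultimately show ?thesis
      unfolding shmulyan_dominates_def by blast
  qed
  ultimately show ?thesis
    by (simp add: shmulyan_equivalent_def)
qed

theorem theorem3p8:
  fixes T :: "'a::complex_hilbert \<Rightarrow> 'a"
  assumes "partial_isometry T"
  shows "harnack_part T = shmulyan_part T \<and> {S \<in> harnack_part T. partial_isometry S} = {T}"
proof
  have harnack: "harnack_part T = {S. strict_perturbation T S}"
    unfolding harnack_part_def
    using strict_perturbation_contraction[OF assms]
      strict_perturbation_imp_harnack_equivalent[OF assms]
      harnack_equivalent_imp_strict_perturbation[OF assms] by blast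
  show "harnack_part T = shmulyan_part T"
    unfolding harnack shmulyan_part_def
    using strict_perturbation_contraction[OF assms]
      strict_perturbation_imp_shmulyan_equivalent[OF assms]
      shmulyan_equivalent_imp_strict_perturbation[OF assms] by blast
  have "strict_perturbation T T"
    using partial_isometry_bounded_clinear[OF assms]
    by (auto simp: strict_perturbation_def intro!: exI[of _ 0])
  then show "{S \<in> harnack_part T. partial_isometry S} = {T}"
    unfolding harnack using strict_perturbation_partial_isometry_eq[OF assms] assms by blast
qed

end
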